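(* Consider the adaptive finite element algorithm with contractive solver (described in the context) for the second-order linear elliptic boundary value problem (described in the context), and the quasi-error $\mathrm{H}_\ell^k:=|||u_\ell^\star-u_\ell^k|||+\eta_\ell(u_\ell^k)$ for $(\ell,k)\in\mathcal{Q}$. Suppose that full R-linear convergence holds, i.e., there are constants $0<q_{\mathrm{lin}}<1$ and $C_{\mathrm{lin}}>0$ such that $$\mathrm{H}_\ell^k\le C_{\mathrm{lin}}\,q_{\mathrm{lin}}^{|\ell,k|-|\ell',k'|}\,\mathrm{H}_{\ell'}^{k'}\quad\text{for all }(\ell',k'),(\ell,k)\in\mathcal{Q}\text{ with }|\ell',k'|\le|\ell,k|.$$ Then, for every $s>0$, $$M(s):=\sup_{(\ell,k)\in\mathcal{Q}}(\#\mathcal{T}_\ell)^s\,\mathrm{H}_\ell^k\le\sup_{(\ell,k)\in\mathcal{Q}}\Big(\sum_{\substack{(\ell',k')\in\mathcal{Q}\\|\ell',k'|\le|\ell,k|}}\ \sum_{\ell''=0}^{\ell'}\#\mathcal{T}_{\ell''}\Big)^s\mathrm{H}_\ell^k\le C_{\mathrm{cost}}(s)\,M(s),$$ where the constant $C_{\mathrm{cost}}(s)>0$ depends only on $C_{\mathrm{lin}}$, $q_{\mathrm{lin}}$, and $s$. Moreover, there exists $s_0>0$ such that $M(s)<\infty$ for all $0<s\le s_0$, with $s_0=\infty$ (i.e., $M(s)<\infty$ for all $s>0$) if $\underline{\ell}<\infty$.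
   Context: **Model problem.** $\Omega\subset\mathbb{R}^d$, $d\ge1$, is a bounded polyhedral Lipschitz domain. Consider $-\operatorname{div}(\boldsymbol{A}\nabla u^\star)+\boldsymbol{b}\cdot\nabla u^\star+cu^\star=f-\operatorname{div}\boldsymbol{f}$ in $\Omega$, $u^\star=0$ on $\partial\Omega$, where $\boldsymbol{A},\boldsymbol{b},c\in L^\infty(\Omega)$, $f,\boldsymbol{f}\in L^2(\Omega)$, and for a.e. $x$: $\boldsymbol{A}(x)\in\mathbb{R}^{d\times d}$ is symmetric positive definite, $\boldsymbol{b}(x),\boldsymbol{f}(x)\in\mathbb{R}^d$, $c(x),f(x)\in\mathbb{R}$. Set $a(u,v):=\langle\boldsymbol{A}\nabla u,\nabla v\rangle_{L^2(\Omega)}$ and $b(u,v):=a(u,v)+\langle\boldsymbol{b}\cdot\nabla u+cu,v\rangle_{L^2(\Omega)}$; both are assumed continuous and elliptic on $H^1_0(\Omega)$. The energy norm is $|||u|||:=a(u,u)^{1/2}$. With $F(v):=\langle f,v\rangle_{L^2(\Omega)}+\langle\boldsymbol{f},\nabla v\rangle_{L^2(\Omega)}$, $u^\star\in H^1_0(\Omega)$ is the unique solution of $b(u^\star,v)=F(v)$ for all $v\in H^1_0(\Omega)$. **Meshes and spaces.** $\mathcal{T}_0$ is an initial conforming simplicial triangulation of $\Omega$. Refinement is by newest-vertex bisection (NVB): for $\mathcal{M}_H\subseteq\mathcal{T}_H$, $\mathtt{refine}(\mathcal{T}_H,\mathcal{M}_H)$ is the coarsest conforming NVB refinement of $\mathcal{T}_H$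 in which at least all elements of $\mathcal{M}_H$ have been refined. $\mathbb{T}$ is the set of meshes obtained from $\mathcal{T}_0$ by finitely many steps of NVB. For fixed $p\in\mathbb{N}$ and $\mathcal{T}_H\in\mathbb{T}$, $\mathcal{X}_H:=\{v_H\in H^1_0(\Omega): v_H|_T$ is a polynomial of total degree $\le p$ for all $T\in\mathcal{T}_H\}$; the Galerkin solution $u_H^\star\in\mathcal{X}_H$ solves $b(u_H^\star,v_H)=F(v_H)$ for all $v_H\in\mathcal{X}_H$. Quantities for the mesh $\mathcal{T}_\ell$ carry the index $\ell$; $\#\mathcal{T}_\ell$ is the number of elements. **Estimator.** $\boldsymbol{A}$ and $\boldsymbol{f}$ are regular enough for the following to be well-defined (e.g. $\boldsymbol{A}|_T,\boldsymbol{f}|_T\in W^{1,\infty}(T)$ for all $T\in\mathcal{T}_0$). For $T\in\mathcal{T}_H$, $v_H\in\mathcal{X}_H$, $$\eta_H(T,v_H)^2:=|T|^{2/d}\|-\operatorname{div}(\boldsymbol{A}\nabla v_H-\boldsymbol{f})+\boldsymbol{b}\cdot\nabla v_H+c\,v_H-f\|_{L^2(T)}^2+|T|^{1/d}\|[\![(\boldsymbol{A}\nabla v_H-\boldsymbol{f})\cdot n]\!]\|_{L^2(\partial T\cap\Omega)}^2,$$ where $[\![\cdot]\!]$ is the jump over $(d-1)$-dimensional faces; $\eta_H(\mathcal{U}_H,v_H):=(\sum_{T\in\mathcal{U}_H}\eta_H(T,v_H)^2)^{1/2}$ for $\mathcal{U}_H\subseteq\mathcal{T}_H$, and $\eta_H(v_H):=\eta_H(\mathcal{T}_H,v_H)$.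 **Contractive solver.** For each $\mathcal{T}_H\in\mathbb{T}$ there is an iteration map $\Psi_H:\mathcal{X}_H\to\mathcal{X}_H$, and there is $0<q_{\mathrm{alg}}<1$ independent of $\mathcal{T}_H$, with $|||u_H^\star-\Psi_H(v_H)|||\le q_{\mathrm{alg}}|||u_H^\star-v_H|||$ for all $\mathcal{T}_H\in\mathbb{T}$, $v_H\in\mathcal{X}_H$. **Algorithm (AFEM with contractive solver).** Input: $\mathcal{T}_0$, $0<\theta\le1$, $C_{\mathrm{mark}}\ge1$, $\lambda>0$, $u_0^0\in\mathcal{X}_0$. For $\ell=0,1,2,\dots$: (i) for $k=1,2,3,\dots$ compute $u_\ell^k:=\Psi_\ell(u_\ell^{k-1})$ and $\eta_\ell(T,u_\ell^k)$ for all $T\in\mathcal{T}_\ell$, until $|||u_\ell^k-u_\ell^{k-1}|||\le\lambda\,\eta_\ell(u_\ell^k)$; (ii) upon termination set $\underline{k}[\ell]:=k\in\mathbb{N}$ and write $u_\ell^{\underline{k}}:=u_\ell^{\underline{k}[\ell]}$; (iii) choose $\mathcal{M}_\ell\in\mathbb{M}_\ell:=\{\mathcal{U}_\ell\subseteq\mathcal{T}_\ell:\theta\,\eta_\ell(u_\ell^{\underline{k}})^2\le\eta_\ell(\mathcal{U}_\ell,u_\ell^{\underline{k}})^2\}$ with $\#\mathcal{M}_\ell\le C_{\mathrm{mark}}\min_{\mathcal{U}_\ell^\star\in\mathbb{M}_\ell}\#\mathcal{U}_\ell^\star$; (iv) set $\mathcal{T}_{\ell+1}:=\mathtt{refine}(\mathcal{T}_\ell,\mathcal{M}_\ell)$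 and $u_{\ell+1}^0:=u_\ell^{\underline{k}}$. If the loop in (i) does not terminate on some mesh, the algorithm stays on that mesh forever. **Index set.** $\mathcal{Q}:=\{(\ell,k)\in\mathbb{N}_0^2: u_\ell^k\in\mathcal{X}_\ell$ is defined in the algorithm$\}$, ordered lexicographically by $(\ell',k')\le(\ell,k)$ iff $u_{\ell'}^{k'}$ is defined not later than $u_\ell^k$; total step counter $|\ell,k|:=\#\{(\ell',k')\in\mathcal{Q}:(\ell',k')\le(\ell,k)\}$; $\underline{\ell}:=\sup\{\ell\in\mathbb{N}_0:(\ell,0)\in\mathcal{Q}\}\in\mathbb{N}_0\cup\{\infty\}$. Suprema may take the value $\infty$. *)

theory Defs
  imports "HOL-Analysis.Analysis"
begin

section \<open>Lebesgue and Sobolev spaces\<close>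

text \<open>
  Functions are total functions on the whole space of which only the values on the domain in
  question matter; elements of Lebesgue and Sobolev spaces are represented by such functions, and
  equality almost everywhere is not divided out.
\<close>

definition L2 :: "(real^'n) set \<Rightarrow> (real^'n \<Rightarrow> 'b::{real_normed_vector}) set" where
  "L2 S = {g. g \<in> borel_measurable (lebesgue_on S) \<and>
              integrable (lebesgue_on S) (\<lambda>x. (norm (g x))\<^sup>2)}"

definition Linf :: "(real^'n) set \<Rightarrow> (real^'n \<Rightarrow> 'b::{real_normed_vector}) set" where
  "Linf S = {g. g \<in> borel_measurable (lebesgue_on S) \<and>
                (\<exists>C. AE x in lebesgue_on S. norm (g x) \<le> C)}"

definition partial :: "'n \<Rightarrow> (real^'n \<Rightarrow> real) \<Rightarrow> real^'n \<Rightarrow> real" where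
  "partial i g x = frechet_derivative g (at x) (axis i 1)"

definition grad :: "(real^'n \<Rightarrow> real) \<Rightarrow> real^'n \<Rightarrow> real^'n" where
  "grad g x = (\<chi> i. partial i g x)"

definition smooth :: "(real^'n \<Rightarrow> real) \<Rightarrow> bool" where
  "smooth g \<longleftrightarrow> (\<forall>is x. fold partial is g differentiable (at x))"

definition test_fun :: "(real^'n) set \<Rightarrow> (real^'n \<Rightarrow> real) \<Rightarrow> bool" where
  "test_fun U \<phi> \<longleftrightarrow> smooth \<phi> \<and> (\<exists>K. compact K \<and> K \<subseteq> U \<and> (\<forall>x. x \<notin> K \<longrightarrow> \<phi> x = 0))"

definition has_weak_grad ::
    "(real^'n) set \<Rightarrow> (real^'n \<Rightarrow> real) \<Rightarrow> (real^'n \<Rightarrow> real^'n) \<Rightarrow> bool" where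
  "has_weak_grad U u g \<longleftrightarrow> u \<in> L2 U \<and> g \<in> L2 U \<and>
     (\<forall>\<phi>. test_fun U \<phi> \<longrightarrow> (\<forall>i.
        (LINT x|lebesgue_on U. u x * partial i \<phi> x) = - (LINT x|lebesgue_on U. g x $ i * \<phi> x)))"

definition has_weak_div ::
    "(real^'n) set \<Rightarrow> (real^'n \<Rightarrow> real^'n) \<Rightarrow> (real^'n \<Rightarrow> real) \<Rightarrow> bool" where
  "has_weak_div U \<sigma> h \<longleftrightarrow> \<sigma> \<in> L2 U \<and> h \<in> L2 U \<and>
     (\<forall>\<phi>. test_fun U \<phi> \<longrightarrow>
        (LINT x|lebesgue_on U. \<sigma> x \<bullet> grad \<phi> x) = - (LINT x|lebesgue_on U. h x * \<phi> x))"

definition wgrad :: "(real^'n) set \<Rightarrow> (real^'n \<Rightarrow> real) \<Rightarrow> real^'n \<Rightarrow> real^'n" where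
  "wgrad U u = (SOME g. has_weak_grad U u g)"

definition wdiv :: "(real^'n) set \<Rightarrow> (real^'n \<Rightarrow> real^'n) \<Rightarrow> real^'n \<Rightarrow> real" where
  "wdiv U \<sigma> = (SOME h. has_weak_div U \<sigma> h)"

definition H1 :: "(real^'n) set \<Rightarrow> (real^'n \<Rightarrow> real) set" where
  "H1 U = {u. \<exists>g. has_weak_grad U u g}"

definition H1_norm :: "(real^'n) set \<Rightarrow> (real^'n \<Rightarrow> real) \<Rightarrow> real" where
  "H1_norm U u = sqrt (LINT x|lebesgue_on U. (u x)\<^sup>2 + (norm (wgrad U u x))\<^sup>2)"

definition H10 :: "(real^'n) set \<Rightarrow> (real^'n \<Rightarrow> real) set" where
  "H10 U = {u \<in> H1 U. \<forall>\<epsilon>>0. \<exists>\<phi>. test_fun U \<phi> \<and> H1_norm U (\<lambda>x. u x - \<phi> x) < \<epsilon>}"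


section \<open>The model problem\<close>

text \<open>The boundary is locally the graph of a Lipschitz function over the hyperplane orthogonal to
  \<open>e\<close>, with the domain strictly on one side of it.\<close>

definition lipschitz_boundary :: "(real^'n) set \<Rightarrow> bool" where
  "lipschitz_boundary U \<longleftrightarrow> (\<forall>z\<in>frontier U. \<exists>V e L \<phi>.
      open V \<and> z \<in> V \<and> norm e = 1 \<and> L-lipschitz_on {y. y \<bullet> e = 0} \<phi> \<and>
      (\<forall>y\<in>V. y \<in> U \<longleftrightarrow> y \<bullet> e > \<phi> (y - (y \<bullet> e) *\<^sub>R e)))"

definition polyhedral_lipschitz_domain :: "(real^'n) set \<Rightarrow> bool" where
  "polyhedral_lipschitz_domain U \<longleftrightarrow> open U \<and> connected U \<and> U \<noteq> {} \<and> bounded U \<and>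
     lipschitz_boundary U \<and>
     (\<exists>\<P>. finite \<P> \<and> (\<forall>C\<in>\<P>. polytope C) \<and> closure U = \<Union>\<P>)"

record 'n pde =
  Dom :: "(real^'n) set"
  coeffA :: "real^'n \<Rightarrow> real^'n^'n"
  coeffb :: "real^'n \<Rightarrow> real^'n"
  coeffc :: "real^'n \<Rightarrow> real"
  rhs :: "real^'n \<Rightarrow> real"
  rhsv :: "real^'n \<Rightarrow> real^'n"

definition form_a :: "'n::finite pde \<Rightarrow> (real^'n \<Rightarrow> real) \<Rightarrow> (real^'n \<Rightarrow> real) \<Rightarrow> real" where
  "form_a P u v = (LINT x|lebesgue_on (Dom P).
      (coeffA P x *v wgrad (Dom P) u x) \<bullet> wgrad (Dom P) v x)"

definition form_b :: "'n::finite pde \<Rightarrow> (real^'n \<Rightarrow> real) \<Rightarrow> (real^'n \<Rightarrow> real) \<Rightarrow> real" where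
  "form_b P u v = form_a P u v + (LINT x|lebesgue_on (Dom P).
      (coeffb P x \<bullet> wgrad (Dom P) u x + coeffc P x * u x) * v x)"

definition load :: "'n::finite pde \<Rightarrow> (real^'n \<Rightarrow> real) \<Rightarrow> real" where
  "load P v = (LINT x|lebesgue_on (Dom P). rhs P x * v x) +
              (LINT x|lebesgue_on (Dom P). rhsv P x \<bullet> wgrad (Dom P) v x)"

definition energy_norm :: "'n::finite pde \<Rightarrow> (real^'n \<Rightarrow> real) \<Rightarrow> real" where
  "energy_norm P u = sqrt (form_a P u u)"

definition continuous_elliptic ::
    "(real^'n) set \<Rightarrow> ((real^'n \<Rightarrow> real) \<Rightarrow> (real^'n \<Rightarrow> real) \<Rightarrow> real) \<Rightarrow> bool" where
  "continuous_elliptic U B \<longleftrightarrow>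
     (\<exists>C. \<forall>u\<in>H10 U. \<forall>v\<in>H10 U. \<bar>B u v\<bar> \<le> C * H1_norm U u * H1_norm U v) \<and>
     (\<exists>\<alpha>>0. \<forall>u\<in>H10 U. B u u \<ge> \<alpha> * (H1_norm U u)\<^sup>2)"

definition model_problem :: "'n::finite pde \<Rightarrow> bool" where
  "model_problem P \<longleftrightarrow>
     polyhedral_lipschitz_domain (Dom P) \<and>
     coeffA P \<in> Linf (Dom P) \<and> coeffb P \<in> Linf (Dom P) \<and> coeffc P \<in> Linf (Dom P) \<and>
     rhs P \<in> L2 (Dom P) \<and> rhsv P \<in> L2 (Dom P) \<and>
     (AE x in lebesgue_on (Dom P). transpose (coeffA P x) = coeffA P x \<and>
        (\<forall>\<xi>. \<xi> \<noteq> 0 \<longrightarrow> \<xi> \<bullet> (coeffA P x *v \<xi>) > 0)) \<and>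
     continuous_elliptic (Dom P) (form_a P) \<and> continuous_elliptic (Dom P) (form_b P)"

definition solves_in ::
    "'n::finite pde \<Rightarrow> (real^'n \<Rightarrow> real) set \<Rightarrow> (real^'n \<Rightarrow> real) \<Rightarrow> bool" where
  "solves_in P X u \<longleftrightarrow> u \<in> X \<and> (\<forall>v\<in>X. form_b P u v = load P v)"


section \<open>Meshes and newest-vertex bisection\<close>

text \<open>
  In any space dimension, newest-vertex bisection is formulated through tagged simplices
  (Maubach): the list of vertices \<open>[x\<^sub>0, \<dots>, x\<^sub>d]\<close> together with a tag \<open>\<gamma> \<in> {1..d}\<close>. The
  refinement edge joins \<open>x\<^sub>0\<close> and \<open>x\<^sub>\<gamma>\<close>. A mesh is a set of tagged simplices.
\<close>

type_synonym 'n tsimplex = "(real^'n) list \<times> nat"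
type_synonym 'n mesh = "'n tsimplex set"

definition verts :: "'n::finite tsimplex \<Rightarrow> (real^'n) set" where
  "verts T = set (fst T)"

definition elem :: "'n::finite tsimplex \<Rightarrow> (real^'n) set" where
  "elem T = convex hull verts T"

definition children :: "'n::finite tsimplex \<Rightarrow> 'n mesh" where
  "children T = (case T of (xs, \<gamma>) \<Rightarrow>
     let m = midpoint (xs ! 0) (xs ! \<gamma>);
         \<gamma>' = (if \<gamma> = 1 then CARD('n) else \<gamma> - 1)
     in {(take \<gamma> xs @ [m] @ drop (\<gamma> + 1) xs, \<gamma>'),
         (take \<gamma> (tl xs) @ [m] @ drop (\<gamma> + 1) xs, \<gamma>')})"

definition bisects_to :: "'n::finite mesh \<Rightarrow> 'n mesh \<Rightarrow> bool" where
  "bisects_to \<T> \<T>' \<longleftrightarrow> (\<exists>T\<in>\<T>. \<T>' = (\<T> - {T}) \<union> children T)"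

text \<open>All refinements by finitely many bisections, conforming or not.\<close>

definition bisection_refinement :: "'n::finite mesh \<Rightarrow> 'n mesh \<Rightarrow> bool" where
  "bisection_refinement = bisects_to\<^sup>*\<^sup>*"

definition conforming :: "'n::finite mesh \<Rightarrow> bool" where
  "conforming \<T> \<longleftrightarrow>
     (\<forall>T\<in>\<T>. \<forall>T'\<in>\<T>. elem T \<inter> elem T' = convex hull (verts T \<inter> verts T'))"

text \<open>
  Besides being a conforming simplicial triangulation of the domain, the initial mesh carries the
  tags that initialise the bisection. Some compatibility is needed for closures to be conforming:
  any two elements list their common vertices in the same order or in reversed order (reversing a
  simplex with tag \<open>d\<close> does not change its descendants as sets). This does not restrict the
  triangulation: sorting the vertices of all elements by one total order, or by any proper vertex
  colouring, is compatible. For \<open>d \<le> 2\<close> the condition always holds (two different elements share at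
  most two vertices), i.e. the refinement edges of the initial triangles are arbitrary.
\<close>

definition initial_triangulation :: "(real^'n) set \<Rightarrow> 'n::finite mesh \<Rightarrow> bool" where
  "initial_triangulation U \<T> \<longleftrightarrow>
     finite \<T> \<and> inj_on verts \<T> \<and> (\<Union>T\<in>\<T>. elem T) = closure U \<and> conforming \<T> \<and>
     (\<forall>(xs, \<gamma>)\<in>\<T>. length xs = CARD('n) + 1 \<and> distinct xs \<and> \<not> affine_dependent (set xs) \<and>
        \<gamma> = CARD('n)) \<and>
     (\<forall>(xs, \<gamma>)\<in>\<T>. \<forall>(ys, \<gamma>')\<in>\<T>.
        let common = set xs \<inter> set ys;
            xs' = filter (\<lambda>x. x \<in> common) xs;
            ys' = filter (\<lambda>x. x \<in> common) ys
        in xs' = ys' \<or> xs' = rev ys')"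

text \<open>\<open>is_refine \<T> \<M> \<T>'\<close>: the mesh \<open>\<T>'\<close> is the coarsest conforming refinement of \<open>\<T>\<close> by
  bisection in which all elements of \<open>\<M>\<close> have been refined.\<close>

definition admissible_refinement :: "'n::finite mesh \<Rightarrow> 'n mesh \<Rightarrow> 'n mesh \<Rightarrow> bool" where
  "admissible_refinement \<T> \<M> \<T>' \<longleftrightarrow>
     bisection_refinement \<T> \<T>' \<and> conforming \<T>' \<and> \<M> \<inter> \<T>' = {}"

definition is_refine :: "'n::finite mesh \<Rightarrow> 'n mesh \<Rightarrow> 'n mesh \<Rightarrow> bool" where
  "is_refine \<T> \<M> \<T>' \<longleftrightarrow> admissible_refinement \<T> \<M> \<T>' \<and>
     (\<forall>\<T>''. admissible_refinement \<T> \<M> \<T>'' \<longrightarrow> bisection_refinement \<T>' \<T>'')"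

inductive_set meshes :: "'n::finite mesh \<Rightarrow> 'n mesh set" for \<T>\<^sub>0 where
  "\<T>\<^sub>0 \<in> meshes \<T>\<^sub>0"
| "\<T> \<in> meshes \<T>\<^sub>0 \<Longrightarrow> \<M> \<subseteq> \<T> \<Longrightarrow> is_refine \<T> \<M> \<T>' \<Longrightarrow> \<T>' \<in> meshes \<T>\<^sub>0"


section \<open>Finite element spaces and error estimator\<close>

definition poly_fun :: "nat \<Rightarrow> (real^'n::finite \<Rightarrow> real) \<Rightarrow> bool" where
  "poly_fun p g \<longleftrightarrow> (\<exists>a :: ('n \<Rightarrow> nat) \<Rightarrow> real.
     \<forall>x. g x = (\<Sum>\<alpha> | (\<Sum>i\<in>UNIV. \<alpha> i) \<le> p. a \<alpha> * (\<Prod>i\<in>UNIV. (x $ i) ^ \<alpha> i)))"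

text \<open>The representative is chosen to be polynomial in the interior of every element; its values on
  the skeleton, a null set, are irrelevant.\<close>

definition fe_space :: "'n::finite pde \<Rightarrow> nat \<Rightarrow> 'n mesh \<Rightarrow> (real^'n \<Rightarrow> real) set" where
  "fe_space P p \<T> = {v \<in> H10 (Dom P).
     \<forall>T\<in>\<T>. \<exists>q. poly_fun p q \<and> (\<forall>x\<in>interior (elem T). v x = q x)}"

text \<open>Inside the elements the gradient of a discrete function is the classical one; this fixes the
  pointwise values needed for the traces on faces.\<close>

definition flux :: "'n::finite pde \<Rightarrow> (real^'n \<Rightarrow> real) \<Rightarrow> real^'n \<Rightarrow> real^'n" where
  "flux P v x = coeffA P x *v grad v x - rhsv P x"

definition residual :: "'n::finite pde \<Rightarrow> 'n tsimplex \<Rightarrow> (real^'n \<Rightarrow> real) \<Rightarrow> real^'n \<Rightarrow> real" where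
  "residual P T v x = - wdiv (interior (elem T)) (flux P v) x + coeffb P x \<bullet> grad v x
                      + coeffc P x * v x - rhs P x"

text \<open>Faces are represented by their sets of vertices.\<close>

definition faces :: "'n::finite tsimplex \<Rightarrow> (real^'n) set set" where
  "faces T = {verts T - {z} | z. z \<in> verts T}"

definition outer_normal :: "'n::finite tsimplex \<Rightarrow> (real^'n) set \<Rightarrow> real^'n" where
  "outer_normal T F = (THE n. norm n = 1 \<and> (\<forall>x\<in>F. \<forall>y\<in>F. (x - y) \<bullet> n = 0) \<and>
                              (\<forall>x\<in>F. \<forall>z\<in>verts T - F. (z - x) \<bullet> n < 0))"

text \<open>
  Surface measure on the hyperplane spanned by \<open>F\<close>: Lebesgue measure on the slab of thickness \<open>1\<close>
  over this hyperplane is the product of surface measure and the length in normal direction, so that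
  its image under the orthogonal projection is the surface measure (the counting measure on a point
  if \<open>d = 1\<close>).
\<close>

definition surface_measure :: "'n::finite tsimplex \<Rightarrow> (real^'n) set \<Rightarrow> (real^'n) measure" where
  "surface_measure T F = (let n = outer_normal T F; y = (SOME y. y \<in> F) in
     distr (lebesgue_on {x. 0 \<le> (x - y) \<bullet> n \<and> (x - y) \<bullet> n \<le> 1}) borel
       (\<lambda>x. x - ((x - y) \<bullet> n) *\<^sub>R n))"

definition trace_from :: "'n::finite tsimplex \<Rightarrow> (real^'n \<Rightarrow> real^'n) \<Rightarrow> real^'n \<Rightarrow> real^'n" where
  "trace_from T \<sigma> x = Lim (at x within interior (elem T)) \<sigma>"

definition normal_jump ::
    "'n::finite mesh \<Rightarrow> (real^'n \<Rightarrow> real^'n) \<Rightarrow> (real^'n) set \<Rightarrow> real^'n \<Rightarrow> real" where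
  "normal_jump \<T> \<sigma> F x = (\<Sum>K | K \<in> \<T> \<and> F \<in> faces K. trace_from K \<sigma> x \<bullet> outer_normal K F)"

definition eta_sq :: "'n::finite pde \<Rightarrow> 'n mesh \<Rightarrow> 'n tsimplex \<Rightarrow> (real^'n \<Rightarrow> real) \<Rightarrow> real" where
  "eta_sq P \<T> T v =
     measure lebesgue (elem T) powr (2 / real CARD('n)) *
       (LINT x|lebesgue_on (elem T). (residual P T v x)\<^sup>2) +
     measure lebesgue (elem T) powr (1 / real CARD('n)) *
       (\<Sum>F\<in>faces T. LINT x|surface_measure T F.
          indicator (convex hull F \<inter> Dom P) x * (normal_jump \<T> (flux P v) F x)\<^sup>2)"

definition eta :: "'n::finite pde \<Rightarrow> 'n mesh \<Rightarrow> 'n mesh \<Rightarrow> (real^'n \<Rightarrow> real) \<Rightarrow> real" where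
  "eta P \<T> \<U> v = sqrt (\<Sum>T\<in>\<U>. eta_sq P \<T> T v)"

text \<open>Regularity of \<open>A\<close> and \<open>\<^bold>f\<close> under which the estimator is meaningful: elementwise weak
  divergence in \<open>L\<^sup>2\<close>, traces on the interior faces, square integrable jumps. It is satisfied
  if \<open>A\<close> and \<open>\<^bold>f\<close> are Lipschitz continuous in the interior of every initial element.\<close>

definition estimator_well_defined :: "'n::finite pde \<Rightarrow> nat \<Rightarrow> 'n mesh \<Rightarrow> bool" where
  "estimator_well_defined P p \<T>\<^sub>0 \<longleftrightarrow>
     (\<forall>\<T>\<in>meshes \<T>\<^sub>0. \<forall>v\<in>fe_space P p \<T>. \<forall>T\<in>\<T>.
        (\<exists>h. has_weak_div (interior (elem T)) (flux P v) h) \<and>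
        (\<forall>F\<in>faces T.
           (AE x in surface_measure T F. x \<in> convex hull F \<inter> Dom P \<longrightarrow>
              (\<exists>l. (flux P v \<longlongrightarrow> l) (at x within interior (elem T)))) \<and>
           integrable (surface_measure T F)
             (\<lambda>x. indicator (convex hull F \<inter> Dom P) x * (normal_jump \<T> (flux P v) F x)\<^sup>2)))"


section \<open>Adaptive algorithm with contractive solver\<close>

definition contractive_solver ::
    "'n::finite pde \<Rightarrow> nat \<Rightarrow> 'n mesh \<Rightarrow> ('n mesh \<Rightarrow> real^'n \<Rightarrow> real) \<Rightarrow>
     ('n mesh \<Rightarrow> (real^'n \<Rightarrow> real) \<Rightarrow> (real^'n \<Rightarrow> real)) \<Rightarrow> bool" where
  "contractive_solver P p \<T>\<^sub>0 ustar \<Psi> \<longleftrightarrow>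
     (\<exists>q\<^sub>a\<^sub>l\<^sub>g. 0 < q\<^sub>a\<^sub>l\<^sub>g \<and> q\<^sub>a\<^sub>l\<^sub>g < 1 \<and>
        (\<forall>\<T>\<in>meshes \<T>\<^sub>0. \<forall>v\<in>fe_space P p \<T>.
           \<Psi> \<T> v \<in> fe_space P p \<T> \<and>
           energy_norm P (\<lambda>x. ustar \<T> x - \<Psi> \<T> v x)
             \<le> q\<^sub>a\<^sub>l\<^sub>g * energy_norm P (\<lambda>x. ustar \<T> x - v x)))"

definition doerfler_sets ::
    "'n::finite pde \<Rightarrow> real \<Rightarrow> 'n mesh \<Rightarrow> (real^'n \<Rightarrow> real) \<Rightarrow> 'n mesh set" where
  "doerfler_sets P \<theta> \<T> v = {\<U>. \<U> \<subseteq> \<T> \<and> \<theta> * (eta P \<T> \<T> v)\<^sup>2 \<le> (eta P \<T> \<U> v)\<^sup>2}"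

definition solver_stops ::
    "'n::finite pde \<Rightarrow> real \<Rightarrow> (nat \<Rightarrow> 'n mesh) \<Rightarrow> (nat \<Rightarrow> nat \<Rightarrow> real^'n \<Rightarrow> real) \<Rightarrow>
     nat \<Rightarrow> nat \<Rightarrow> bool" where
  "solver_stops P lam \<T> u l k \<longleftrightarrow> 1 \<le> k \<and>
     energy_norm P (\<lambda>x. u l k x - u l (k - 1) x) \<le> lam * eta P (\<T> l) (\<T> l) (u l k)"

text \<open>The index set generated by a stopping predicate.\<close>

inductive_set index_set :: "(nat \<Rightarrow> nat \<Rightarrow> bool) \<Rightarrow> (nat \<times> nat) set"
  for stops :: "nat \<Rightarrow> nat \<Rightarrow> bool" where
  "(0, 0) \<in> index_set stops"
| "(l, k) \<in> index_set stops \<Longrightarrow> \<not> stops l k \<Longrightarrow> (l, Suc k) \<in> index_set stops"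
| "(l, k) \<in> index_set stops \<Longrightarrow> stops l k \<Longrightarrow> (Suc l, 0) \<in> index_set stops"

text \<open>A run of the algorithm: meshes \<open>\<T> l\<close>, marked elements \<open>\<M> l\<close> and iterates \<open>u l k\<close>. Nothing is
  required of values with indices outside the index set.\<close>

definition afem_run ::
    "'n::finite pde \<Rightarrow> nat \<Rightarrow> ('n mesh \<Rightarrow> (real^'n \<Rightarrow> real) \<Rightarrow> (real^'n \<Rightarrow> real)) \<Rightarrow>
     'n mesh \<Rightarrow> real \<Rightarrow> real \<Rightarrow> real \<Rightarrow> (real^'n \<Rightarrow> real) \<Rightarrow>
     (nat \<Rightarrow> 'n mesh) \<Rightarrow> (nat \<Rightarrow> 'n mesh) \<Rightarrow> (nat \<Rightarrow> nat \<Rightarrow> real^'n \<Rightarrow> real) \<Rightarrow> bool" where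
  "afem_run P p \<Psi> \<T>\<^sub>0 \<theta> Cmark lam u00 \<T> \<M> u \<longleftrightarrow>
     \<T> 0 = \<T>\<^sub>0 \<and> u00 \<in> fe_space P p \<T>\<^sub>0 \<and> u 0 0 = u00 \<and>
     (\<forall>(l, k) \<in> index_set (solver_stops P lam \<T> u).
        if solver_stops P lam \<T> u l k
        then \<M> l \<in> doerfler_sets P \<theta> (\<T> l) (u l k) \<and>
             real (card (\<M> l)) \<le>
               Cmark * real (Min (card ` doerfler_sets P \<theta> (\<T> l) (u l k))) \<and>
             is_refine (\<T> l) (\<M> l) (\<T> (Suc l)) \<and>
             u (Suc l) 0 = u l k
        else u l (Suc k) = \<Psi> (\<T> l) (u l k))"

definition lex_le :: "nat \<times> nat \<Rightarrow> nat \<times> nat \<Rightarrow> bool" where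
  "lex_le = (\<lambda>(l', k') (l, k). l' < l \<or> l' = l \<and> k' \<le> k)"

definition step_count :: "(nat \<times> nat) set \<Rightarrow> nat \<times> nat \<Rightarrow> nat" where
  "step_count Q i = card {j \<in> Q. lex_le j i}"

definition last_level :: "(nat \<times> nat) set \<Rightarrow> enat" where
  "last_level Q = (SUP l\<in>{l. (l, 0) \<in> Q}. enat l)"

definition quasi_error ::
    "'n::finite pde \<Rightarrow> ('n mesh \<Rightarrow> real^'n \<Rightarrow> real) \<Rightarrow> (nat \<Rightarrow> 'n mesh) \<Rightarrow>
     (nat \<Rightarrow> nat \<Rightarrow> real^'n \<Rightarrow> real) \<Rightarrow> nat \<times> nat \<Rightarrow> real" where
  "quasi_error P ustar \<T> u = (\<lambda>(l, k).
     energy_norm P (\<lambda>x. ustar (\<T> l) x - u l k x) + eta P (\<T> l) (\<T> l) (u l k))"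

definition full_R_linear :: "(nat \<times> nat) set \<Rightarrow> (nat \<times> nat \<Rightarrow> real) \<Rightarrow> real \<Rightarrow> real \<Rightarrow> bool" where
  "full_R_linear Q H Clin qlin \<longleftrightarrow>
     (\<forall>j\<in>Q. \<forall>i\<in>Q. step_count Q j \<le> step_count Q i \<longrightarrow>
        H i \<le> Clin * qlin ^ (step_count Q i - step_count Q j) * H j)"

definition rate_dofs ::
    "(nat \<times> nat) set \<Rightarrow> (nat \<Rightarrow> 'n mesh) \<Rightarrow> (nat \<times> nat \<Rightarrow> real) \<Rightarrow> real \<Rightarrow> ennreal" where
  "rate_dofs Q \<T> H s = (SUP i\<in>Q. ennreal (real (card (\<T> (fst i))) powr s * H i))"

definition rate_cost ::
    "(nat \<times> nat) set \<Rightarrow> (nat \<Rightarrow> 'n mesh) \<Rightarrow> (nat \<times> nat \<Rightarrow> real) \<Rightarrow> real \<Rightarrow> ennreal" where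
  "rate_cost Q \<T> H s = (SUP i\<in>Q. ennreal (
     real (\<Sum>j | j \<in> Q \<and> step_count Q j \<le> step_count Q i. \<Sum>l\<le>fst j. card (\<T> l)) powr s * H i))"

text \<open>
  The constant comes from two applications of the geometric series with ratio \<open>qlin\<^sup>1\<^sup>/\<^sup>s\<close>.
  It is given explicitly because a constant asserted to exist for a fixed type of coordinates could
  depend on the space dimension.
\<close>

definition C_cost :: "real \<Rightarrow> real \<Rightarrow> real \<Rightarrow> real" where
  "C_cost Clin qlin s = Clin\<^sup>2 / (1 - qlin powr (1 / s)) powr (2 * s)"

end

theory Submission
  imports Defs
begin

text \<open>
  Cumulative cost dominates the current mesh size because the current step is one of the steps
  summed over. For the converse, let \<open>r = qlin powr (1 / s)\<close>. If every step
  \<open>j\<close> satisfies \<open>#T\<^sub>j powr s * H j \<le> M\<close>, then R-linear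
  convergence from \<open>j\<close> to a later step \<open>i\<close> gives \<open>#T\<^sub>j * (H
  i) powr (1 / s) \<le> (Clin * M) powr (1 / s) * r ^ (|i| - |j|)\<close>. The right-hand side is
  geometric in the step counter, so that both summations of the mesh sizes, over the levels and
  over the steps, cost one factor \<open>1 / (1 - r)\<close> each. No division by a quasi-error
  occurs, hence vanishing errors are harmless.

  The rates are finite for the following reason. Since the step counter exceeds the level,
  R-linear convergence makes the quasi-error decay like \<open>qlin ^ l\<close> in the level
  \<open>l\<close>. With finitely many levels all rates are finite. In general it remains to show
  that the meshes grow at most exponentially with the level; \<open>run_mesh_card_le\<close> has
  the bound \<open>K * (2 ^ d) ^ l\<close>, and \<open>s\<^sub>0\<close> is the rate for which
  growth and decay balance.

  The growth is controlled by comparison. Since \<open>is_refine\<close> yields the coarsest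
  admissible refinement, the next mesh is bounded by any admissible competitor. The competitor on
  level \<open>l + 1\<close> is the \<open>(l + 1)\<close>-fold uniform refinement of the initial
  mesh, in which every element is bisected \<open>d\<close> times per level. Inductively, the mesh
  on level \<open>l\<close> is refined by the uniform mesh on level \<open>l\<close>, hence also
  by the one on level \<open>l + 1\<close>, with which it has no element in common. So the marked
  elements are refined there, and the competitor is admissible as soon as uniform refinements are
  conforming.

  This conformity is a matter of combinatorics. Bisecting \<open>[x\<^sub>0, \<dots>,
  x\<^sub>d]\<close> with tag \<open>d\<close> successively \<open>d\<close> times produces one
  simplex for every maximal chain of nested segments \<open>[x\<^sub>a] \<subset> \<dots>
  \<subset> [x\<^sub>0, \<dots>, x\<^sub>d]\<close>; its vertices are the midpoints of the end
  points of the segments, listed in increasing order (\<open>bisect_all_pow_segment\<close>). A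
  convex combination of such midpoints determines its weights: the outermost edge of positive
  weight is recovered from the support of the barycentric coordinates, and one can peel it off
  (\<open>chain_weights_unique\<close>). This argument only uses which vertices lie between two
  given ones, a relation that does not change when the list is reversed and that is inherited by
  the vertices of a common face. Therefore it applies simultaneously to two neighbouring simplices
  that list their common vertices in the same or in reversed order, and shows that their
  subsimplices meet in common faces, with common vertices in the same order. So the compatibility
  of the initial mesh is inherited by its uniform refinements
  (\<open>compatible_mesh_uniform_refinement\<close>).
\<close>

section \<open>The index set of a run\<close>

text \<open>An index on a level is only reached by continuing at all earlier indices of that
  level. Hence the index at which the solver stops is the last one of its level.\<close>

lemma index_set_not_stopped:
  "(l, k) \<in> index_set stops \<Longrightarrow> \<forall>k' < k. \<not> stops l k'"
  by (induction l k rule: index_set.induct) (auto simp: less_Suc_eq)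

lemma index_set_level_start:
  "(l, k) \<in> index_set stops \<Longrightarrow> l' \<le> l \<Longrightarrow> (l', 0) \<in> index_set stops"
proof (induction l k rule: index_set.induct)
  case (3 l k)
  then show ?case
    using index_set.intros(3)[of l k stops] by (cases "l' = Suc l") auto
qed (auto intro: index_set.intros)

lemma lex_le_refl [simp]: "lex_le i i"
  by (auto simp: lex_le_def)

lemma lex_le_trans: "lex_le i j \<Longrightarrow> lex_le j k \<Longrightarrow> lex_le i k"
  by (auto simp: lex_le_def)

lemma lex_le_antisym: "lex_le i j \<Longrightarrow> lex_le j i \<Longrightarrow> i = j"
  by (auto simp: lex_le_def)

lemma lex_le_total: "lex_le i j \<or> lex_le j i"
  by (auto simp: lex_le_def)

text \<open>Although a level may contain infinitely many indices, no later level is reached in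
  that case.\<close>

lemma finite_predecessors:
  assumes "i \<in> index_set stops"
  shows "finite {j \<in> index_set stops. lex_le j i}"
proof -
  have "(l, k) \<in> index_set stops \<Longrightarrow> finite {j \<in> index_set stops. lex_le j (l, k)}" for l k
  proof (induction l k rule: index_set.induct)
    case 1
    have "{j \<in> index_set stops. lex_le j (0, 0)} \<subseteq> {(0, 0)}"
      by (auto simp: lex_le_def)
    then show ?case by (rule finite_subset) simp
  next
    case (2 l k)
    have "{j \<in> index_set stops. lex_le j (l, Suc k)}
        \<subseteq> insert (l, Suc k) {j \<in> index_set stops. lex_le j (l, k)}"
      by (auto simp: lex_le_def)
    then show ?case by (rule finite_subset) (use 2 in simp)
  next
    case (3 l k)
    have "lex_le j (l, k)" if "j \<in> index_set stops" "fst j \<le> l" for j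
      using index_set_not_stopped[of "fst j" "snd j" stops] that 3
      by (cases j) (auto simp: lex_le_def not_le[symmetric])
    then have "{j \<in> index_set stops. lex_le j (Suc l, 0)}
        \<subseteq> insert (Suc l, 0) {j \<in> index_set stops. lex_le j (l, k)}"
      by (fastforce simp: lex_le_def)
    then show ?case by (rule finite_subset) (use 3 in simp)
  qed
  then show ?thesis using assms by (cases i) simp
qed

text \<open>Counting predecessors turns the lexicographic order of the index set into the order of
  the natural numbers.\<close>

lemma step_count_le_iff:
  assumes "i \<in> index_set stops" "j \<in> index_set stops"
  shows "step_count (index_set stops) j \<le> step_count (index_set stops) i \<longleftrightarrow> lex_le j i"
proof
  assume "lex_le j i"
  then show "step_count (index_set stops) j \<le> step_count (index_set stops) i"
    unfolding step_count_def
    by (intro card_mono finite_predecessors assms) (auto intro: lex_le_trans)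
next
  assume le: "step_count (index_set stops) j \<le> step_count (index_set stops) i"
  show "lex_le j i"
  proof (rule ccontr)
    assume n: "\<not> lex_le j i"
    then have "lex_le i j" using lex_le_total by blast
    then have "{m \<in> index_set stops. lex_le m i} \<subset> {m \<in> index_set stops. lex_le m j}"
      using n assms lex_le_refl[of j] lex_le_trans by blast
    from psubset_card_mono[OF finite_predecessors[OF assms(2)] this] le
    show False by (simp add: step_count_def)
  qed
qed

lemma inj_on_step_count: "inj_on (step_count (index_set stops)) (index_set stops)"
  by (rule inj_onI) (metis lex_le_antisym order_refl step_count_le_iff)

lemma predecessors_eq:
  assumes "i \<in> index_set stops"
  shows "{j. j \<in> index_set stops \<and> step_count (index_set stops) j \<le> step_count (index_set stops) i}
       = {j \<in> index_set stops. lex_le j i}"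
  using step_count_le_iff[OF assms] by auto

text \<open>Each of the levels up to the current one has contributed its initial index.\<close>

lemma level_less_step_count:
  assumes "i \<in> index_set stops"
  shows "fst i < step_count (index_set stops) i"
proof -
  have "(\<lambda>l. (l, 0)) ` {..fst i} \<subseteq> {j \<in> index_set stops. lex_le j i}"
    using index_set_level_start[of "fst i" "snd i"] assms by (cases i) (auto simp: lex_le_def)
  from card_mono[OF finite_predecessors[OF assms] this]
  show ?thesis by (simp add: step_count_def card_image inj_on_def)
qed

lemma step_count_start: "step_count (index_set stops) (0, 0) = 1"
proof -
  have "{j \<in> index_set stops. lex_le j (0, 0)} = {(0, 0)}"
    by (auto simp: lex_le_def intro: index_set.intros)
  then show ?thesis by (simp add: step_count_def)
qed

section \<open>Cumulative cost and degrees of freedom\<close>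

text \<open>The real square root is odd, so that the sign of the form matters. It is nonnegative
  because the coefficient matrix is positive definite at almost every point.\<close>

lemma energy_norm_nonneg:
  assumes "model_problem P"
  shows "0 \<le> energy_norm P v"
proof -
  have "AE x in lebesgue_on (Dom P). \<forall>\<xi>. \<xi> \<noteq> 0 \<longrightarrow> \<xi> \<bullet> (coeffA P x *v \<xi>) > 0"
    using assms by (auto simp: model_problem_def)
  then have "AE x in lebesgue_on (Dom P). 0 \<le> (coeffA P x *v wgrad (Dom P) v x) \<bullet> wgrad (Dom P) v x"
    by eventually_elim (metis inner_commute inner_zero_right less_imp_le order_refl)
  then have "0 \<le> form_a P v v"
    unfolding form_a_def by (rule integral_nonneg_AE)
  then show ?thesis by (simp add: energy_norm_def)
qed

lemma eta_nonneg: "0 \<le> eta P \<T> \<U> v"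
  by (auto simp: eta_def eta_sq_def intro!: sum_nonneg add_nonneg_nonneg mult_nonneg_nonneg Bochner_Integration.integral_nonneg)

lemma quasi_error_nonneg: "model_problem P \<Longrightarrow> 0 \<le> quasi_error P ustar \<T> u i"
  by (cases i) (simp add: quasi_error_def energy_norm_nonneg eta_nonneg)

text \<open>Different steps have different counters, so the sum is part of a geometric series.\<close>

lemma sum_geometric_predecessors:
  fixes r :: real
  assumes i: "i \<in> index_set stops" and r: "0 \<le> r" "r < 1"
  shows "(\<Sum>j | j \<in> index_set stops \<and> lex_le j i.
            r ^ (step_count (index_set stops) i - step_count (index_set stops) j)) \<le> 1 / (1 - r)"
proof -
  let ?c = "step_count (index_set stops)"
  let ?A = "{j \<in> index_set stops. lex_le j i}"
  have inj: "inj_on (\<lambda>j. ?c i - ?c j) ?A"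
  proof (rule inj_onI)
    fix j k assume jk: "j \<in> ?A" "k \<in> ?A" "?c i - ?c j = ?c i - ?c k"
    then have "?c j \<le> ?c i" "?c k \<le> ?c i" using step_count_le_iff i by blast+
    with jk(3) have "?c j = ?c k" by linarith
    then show "j = k" using jk inj_on_step_count by (blast dest: inj_onD)
  qed
  have "(\<Sum>j\<in>?A. r ^ (?c i - ?c j)) = (\<Sum>n\<in>(\<lambda>j. ?c i - ?c j) ` ?A. r ^ n)"
    by (simp add: sum.reindex[OF inj])
  also have "\<dots> \<le> (\<Sum>n. r ^ n)"
    using r finite_predecessors[OF i] by (intro sum_le_suminf summable_geometric) auto
  also have "\<dots> = 1 / (1 - r)"
    using r by (simp add: suminf_geometric)
  finally show ?thesis .
qed

lemma rate_dofs_le_rate_cost: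
  assumes Q: "Q = index_set stops" and H: "\<And>i. i \<in> Q \<Longrightarrow> 0 \<le> H i" and s: "0 < s"
  shows "rate_dofs Q \<T> H s \<le> rate_cost Q \<T> H s"
  unfolding rate_dofs_def rate_cost_def
proof (rule SUP_subset_mono)
  show "Q \<subseteq> Q" ..
  fix i assume i: "i \<in> Q"
  have "card (\<T> (fst i)) \<le> (\<Sum>l\<le>fst i. card (\<T> l))"
    by (rule member_le_sum) auto
  also have "\<dots> \<le> (\<Sum>j | j \<in> Q \<and> step_count Q j \<le> step_count Q i. \<Sum>l\<le>fst j. card (\<T> l))"
    using i finite_predecessors[of i stops] unfolding Q predecessors_eq[OF i[unfolded Q]]
    by (intro member_le_sum[of i _ "\<lambda>j. \<Sum>l\<le>fst j. card (\<T> l)"]) auto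
  finally have "real (card (\<T> (fst i)))
      \<le> real (\<Sum>j | j \<in> Q \<and> step_count Q j \<le> step_count Q i. \<Sum>l\<le>fst j. card (\<T> l))"
    by (simp only: of_nat_le_iff)
  then show "ennreal (real (card (\<T> (fst i))) powr s * H i) \<le>
      ennreal (real (\<Sum>j | j \<in> Q \<and> step_count Q j \<le> step_count Q i. \<Sum>l\<le>fst j. card (\<T> l)) powr s * H i)"
    using H[OF i] s by (intro ennreal_leI mult_right_mono powr_mono2) auto
qed

lemma C_cost_pos:
  assumes "0 < qlin" "qlin < 1" "0 < Clin" "0 < s"
  shows "0 < C_cost Clin qlin s"
proof -
  have "qlin powr (1 / s) < 1 powr (1 / s)"
    using assms by (intro powr_less_mono2) auto
  then show ?thesis using assms by (simp add: C_cost_def)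
qed

text \<open>Raising R-linear convergence to the power \<open>1 / s\<close> bounds the size of each
  earlier mesh, weighted with the current quasi-error, by a geometric sequence in the step
  counter. The inner sum over the levels is dominated by a sum over all earlier steps, because
  every level owns an index \<open>(l, 0)\<close>, and reproduces the geometric bound; the outer
  sum is then geometric again. This yields the bound with \<open>Clin\<close> in place of
  \<open>Clin\<^sup>2\<close>, and \<open>1 \<le> Clin\<close> unless the current quasi-error
  vanishes, as R-linear convergence from a step to itself shows.\<close>

lemma cumulative_cost_le:
  fixes N :: "nat \<Rightarrow> nat"
  assumes Q: "Q = index_set stops" and H: "\<And>i. i \<in> Q \<Longrightarrow> 0 \<le> H i"
    and lin: "full_R_linear Q H Clin qlin" and q: "0 < qlin" "qlin < 1" and C: "0 < Clin"
    and s: "0 < s" and M: "\<And>j. j \<in> Q \<Longrightarrow> real (N (fst j)) powr s * H j \<le> M"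
    and i: "i \<in> Q"
  shows "real (\<Sum>j | j \<in> Q \<and> step_count Q j \<le> step_count Q i. \<Sum>l\<le>fst j. N l) powr s * H i
         \<le> C_cost Clin qlin s * M"
proof (cases "H i = 0")
  case True
  have "0 \<le> M" using M[OF i] True by simp
  then show ?thesis using True C_cost_pos[OF q C s] by simp
next
  case False
  then have Hi: "0 < H i" using H[OF i] by simp
  have "H i \<le> Clin * H i"
    using lin i unfolding full_R_linear_def by force
  then have C1: "1 \<le> Clin" using Hi by simp
  have M0: "0 \<le> M" using M[OF i] H[OF i] by (smt (verit) mult_nonneg_nonneg powr_ge_zero)
  define r where "r = qlin powr (1 / s)"
  have "qlin powr (1 / s) < 1 powr (1 / s)"
    using q s by (intro powr_less_mono2) auto
  then have r: "0 \<le> r" "r < 1" by (auto simp: r_def)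
  define h where "h = H i powr (1 / s)"
  define K where "K = (Clin * M) powr (1 / s)"
  have K0: "0 \<le> K" by (simp add: K_def)
  let ?c = "step_count Q"
  let ?A = "\<lambda>j. {k \<in> index_set stops. lex_le k j}"
  have single: "real (N (fst j)) * h \<le> K * r ^ (?c i - ?c j)" if j: "j \<in> Q" "lex_le j i" for j
  proof -
    have "?c j \<le> ?c i" using j i step_count_le_iff unfolding Q by blast
    then have "H i \<le> Clin * qlin ^ (?c i - ?c j) * H j"
      using lin i j unfolding full_R_linear_def by blast
    then have "real (N (fst j)) powr s * H i
        \<le> real (N (fst j)) powr s * (Clin * qlin ^ (?c i - ?c j) * H j)"
      by (rule mult_left_mono) simp
    also have "\<dots> = Clin * qlin ^ (?c i - ?c j) * (real (N (fst j)) powr s * H j)"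
      by simp
    also have "\<dots> \<le> Clin * qlin ^ (?c i - ?c j) * M"
      using M[OF j(1)] C q by (intro mult_left_mono) auto
    finally have "(real (N (fst j)) powr s * H i) powr (1 / s)
        \<le> (Clin * M * qlin ^ (?c i - ?c j)) powr (1 / s)"
      using s Hi by (intro powr_mono2) (auto simp: mult_ac)
    also have "\<dots> = K * r ^ (?c i - ?c j)"
      using q C M0 by (simp add: powr_mult K_def r_def powr_powr mult.commute flip: powr_realpow)
    also have "(real (N (fst j)) powr s * H i) powr (1 / s) = real (N (fst j)) * h"
      using s Hi by (simp add: powr_mult powr_powr h_def)
    finally show ?thesis .
  qed
  have inner: "(\<Sum>l\<le>fst j. real (N l)) * h \<le> K / (1 - r) * r ^ (?c i - ?c j)"
    if j: "j \<in> Q" "lex_le j i" for j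
  proof -
    have cji: "?c j \<le> ?c i" using j i step_count_le_iff unfolding Q by blast
    have "(\<Sum>l\<le>fst j. real (N l)) = (\<Sum>k\<in>(\<lambda>l. (l, 0::nat)) ` {..fst j}. real (N (fst k)))"
      by (subst sum.reindex) (auto simp: inj_on_def)
    also have "\<dots> \<le> (\<Sum>k\<in>?A j. real (N (fst k)))"
      using j index_set_level_start[of "fst j" "snd j" stops] finite_predecessors[of j stops]
      unfolding Q by (intro sum_mono2) (auto simp: lex_le_def)
    finally have "(\<Sum>l\<le>fst j. real (N l)) * h \<le> (\<Sum>k\<in>?A j. real (N (fst k)) * h)"
      unfolding sum_distrib_right[symmetric] by (rule mult_right_mono) (simp add: h_def)
    also have "\<dots> \<le> (\<Sum>k\<in>?A j. K * r ^ (?c i - ?c j) * r ^ (?c j - ?c k))"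
    proof (rule sum_mono)
      fix k assume k: "k \<in> ?A j"
      then have "?c k \<le> ?c j" using j step_count_le_iff unfolding Q by blast
      then have "?c i - ?c k = (?c i - ?c j) + (?c j - ?c k)" using cji by linarith
      then show "real (N (fst k)) * h \<le> K * r ^ (?c i - ?c j) * r ^ (?c j - ?c k)"
        using single[OF _ lex_le_trans[OF _ j(2)], of k] k Q by (auto simp: power_add mult_ac)
    qed
    also have "\<dots> = K * r ^ (?c i - ?c j) * (\<Sum>k\<in>?A j. r ^ (?c j - ?c k))"
      by (simp add: sum_distrib_left)
    also have "\<dots> \<le> K * r ^ (?c i - ?c j) * (1 / (1 - r))"
      using sum_geometric_predecessors[of j stops r] j r K0 unfolding Q
      by (intro mult_left_mono) auto
    finally show ?thesis by (simp add: field_simps)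
  qed
  define S where "S = real (\<Sum>j | j \<in> Q \<and> ?c j \<le> ?c i. \<Sum>l\<le>fst j. N l)"
  have "S * h = (\<Sum>j\<in>?A i. (\<Sum>l\<le>fst j. real (N l)) * h)"
    using predecessors_eq i unfolding Q S_def by (simp add: sum_distrib_right)
  also have "\<dots> \<le> (\<Sum>j\<in>?A i. K / (1 - r) * r ^ (?c i - ?c j))"
    using inner Q by (intro sum_mono) auto
  also have "\<dots> = K / (1 - r) * (\<Sum>j\<in>?A i. r ^ (?c i - ?c j))"
    by (simp add: sum_distrib_left)
  also have "\<dots> \<le> K / (1 - r) * (1 / (1 - r))"
    using sum_geometric_predecessors[of i stops r] i r K0 unfolding Q
    by (intro mult_left_mono) auto
  finally have "(S * h) powr s \<le> (K / (1 - r)^2) powr s"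
    using s by (intro powr_mono2) (auto simp: S_def h_def power2_eq_square simp del: of_nat_sum)
  moreover have "(S * h) powr s = S powr s * H i"
    using s Hi by (simp add: powr_mult powr_powr h_def S_def)
  moreover have "(K / (1 - r)^2) powr s = Clin * M / (1 - r) powr (2 * s)"
  proof -
    have "(K / (1 - r)^2) powr s = K powr s / ((1 - r)^2) powr s"
      by (rule powr_divide)
    also have "K powr s = Clin * M"
      using s C M0 by (simp add: K_def powr_powr)
    also have "((1 - r)^2) powr s = (1 - r) powr (2 * s)"
      using r by (simp add: powr_powr flip: powr_numeral)
    finally show ?thesis .
  qed
  moreover have "Clin * M / (1 - r) powr (2 * s) \<le> C_cost Clin qlin s * M"
    unfolding C_cost_def r_def[symmetric]
    using mult_right_mono[OF mult_left_mono[OF C1, of Clin] M0] C r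
    by (auto simp: power2_eq_square intro!: divide_right_mono)
  ultimately show ?thesis unfolding S_def by linarith
qed

lemma rate_cost_le_rate_dofs:
  assumes Q: "Q = index_set stops" and H: "\<And>i. i \<in> Q \<Longrightarrow> 0 \<le> H i"
    and lin: "full_R_linear Q H Clin qlin" and q: "0 < qlin" "qlin < 1" and C: "0 < Clin"
    and s: "0 < s"
  shows "rate_cost Q \<T> H s \<le> ennreal (C_cost Clin qlin s) * rate_dofs Q \<T> H s"
proof (cases "rate_dofs Q \<T> H s")
  case (real M)
  have "real (card (\<T> (fst j))) powr s * H j \<le> M" if "j \<in> Q" for j
  proof -
    have "ennreal (real (card (\<T> (fst j))) powr s * H j) \<le> rate_dofs Q \<T> H s"
      unfolding rate_dofs_def using that by (rule SUP_upper)
    then show ?thesis using real by simp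
  qed
  note bound = cumulative_cost_le[OF Q H lin q C s this]
  have "rate_cost Q \<T> H s \<le> ennreal (C_cost Clin qlin s * M)"
    unfolding rate_cost_def by (intro SUP_least ennreal_leI bound)
  then show ?thesis using real C_cost_pos[OF q C s] by (simp add: ennreal_mult)
next
  case top
  then show ?thesis using C_cost_pos[OF q C s] by (simp add: ennreal_mult_top)
qed

section \<open>Order-convex hulls in a list\<close>

text \<open>The order in which the entries of a list occur. By recursion on the list, it behaves
  well under filtering and reversal even if entries are repeated.\<close>

fun list_le :: "'a list \<Rightarrow> 'a \<Rightarrow> 'a \<Rightarrow> bool" where
  "list_le [] x y \<longleftrightarrow> False"
| "list_le (a # xs) x y \<longleftrightarrow> x = a \<and> y \<in> set (a # xs) \<or> list_le xs x y"

lemma list_le_in_set: "list_le xs x y \<Longrightarrow> x \<in> set xs \<and> y \<in> set xs"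
  by (induction xs) auto

lemma list_le_refl: "list_le xs x x \<longleftrightarrow> x \<in> set xs"
  by (induction xs) auto

lemma list_le_filter: "list_le (filter F xs) x y \<longleftrightarrow> list_le xs x y \<and> F x \<and> F y"
  by (induction xs) (auto dest: list_le_in_set)

lemma list_le_append:
  "list_le (xs @ ys) x y \<longleftrightarrow> list_le xs x y \<or> list_le ys x y \<or> x \<in> set xs \<and> y \<in> set ys"
  by (induction xs) auto

lemma list_le_rev: "list_le (rev xs) x y \<longleftrightarrow> list_le xs y x"
  by (induction xs) (auto simp: list_le_append)

lemma list_le_total: "x \<in> set xs \<Longrightarrow> y \<in> set xs \<Longrightarrow> list_le xs x y \<or> list_le xs y x"
  by (induction xs) auto

lemma list_le_antisym: "distinct xs \<Longrightarrow> list_le xs x y \<Longrightarrow> list_le xs y x \<Longrightarrow> x = y"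
  by (induction xs) (auto dest: list_le_in_set)

lemma list_le_trans: "distinct xs \<Longrightarrow> list_le xs x y \<Longrightarrow> list_le xs y z \<Longrightarrow> list_le xs x z"
  by (induction xs) (auto dest: list_le_in_set)

definition list_hull :: "'a list \<Rightarrow> 'a set \<Rightarrow> 'a set" where
  "list_hull xs e = {z. \<exists>x\<in>e. \<exists>y\<in>e. list_le xs x z \<and> list_le xs z y}"

text \<open>The hull of a set consists of the entries between two of its elements. Being symmetric
  in these two, it is insensitive to reversing the list; this is what makes reversed vertex orders
  on a common face acceptable.\<close>

lemma list_hull_rev: "list_hull (rev xs) e = list_hull xs e"
  by (auto simp: list_hull_def list_le_rev)

text \<open>Hulls restrict to sublists, that is, to the vertices of a face.\<close>

lemma list_hull_filter:
  assumes "e \<subseteq> F"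
  shows "list_hull (filter (\<lambda>x. x \<in> F) xs) e = list_hull xs e \<inter> F"
  using assms by (auto simp: list_hull_def list_le_filter)

lemma subset_list_hull: "e \<subseteq> set xs \<Longrightarrow> e \<subseteq> list_hull xs e"
  unfolding list_hull_def using list_le_refl by fast

lemma list_hull_least:
  assumes "distinct xs" "e \<subseteq> list_hull xs e'"
  shows "list_hull xs e \<subseteq> list_hull xs e'"
proof
  fix z assume "z \<in> list_hull xs e"
  then obtain x y where "x \<in> e" "y \<in> e" "list_le xs x z" "list_le xs z y"
    by (auto simp: list_hull_def)
  then show "z \<in> list_hull xs e'"
    using assms list_le_trans[OF assms(1)] unfolding list_hull_def by blast
qed

lemma ordered_pairE:
  assumes "e \<subseteq> set xs" "e \<noteq> {}" "card e \<le> 2"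
  obtains x y where "e = {x, y}" "list_le xs x y"
proof -
  have "finite e" using assms(1) finite_subset by blast
  then have "card e = 1 \<or> card e = 2" using assms(2,3) by (auto simp: card_gt_0_iff le_Suc_eq numeral_2_eq_2)
  then obtain x y where e: "e = {x, y}" by (auto simp: card_1_singleton_iff card_2_iff)
  then have "list_le xs x y \<or> list_le xs y x" using assms(1) list_le_total[of x xs y] by simp
  then show thesis using e that by (auto simp: insert_commute)
qed

text \<open>An edge consists of the first and the last element of its hull.\<close>

lemma list_hull_inject:
  assumes "distinct xs" "e \<subseteq> set xs" "e \<noteq> {}" "card e \<le> 2" "e' \<subseteq> set xs" "e' \<noteq> {}" "card e' \<le> 2"
    and "list_hull xs e = list_hull xs e'"
  shows "e = e'"
proof -
  have sub: "e \<subseteq> list_hull xs e'" "e' \<subseteq> list_hull xs e"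
    using subset_list_hull assms by metis+
  obtain x y where e: "e = {x, y}" "list_le xs x y" using assms ordered_pairE by metis
  obtain x' y' where e': "e' = {x', y'}" "list_le xs x' y'" using assms ordered_pairE by metis
  have "list_le xs x' x" "list_le xs y y'" "list_le xs x x'" "list_le xs y' y"
    using sub e(2) e'(2) list_le_trans[OF assms(1)] unfolding list_hull_def e(1) e'(1) by blast+
  then have "x = x'" "y = y'" using list_le_antisym[OF assms(1)] by blast+
  then show ?thesis using e(1) e'(1) by simp
qed

lemma list_le_hd_last: "z \<in> set zs \<Longrightarrow> list_le zs (hd zs) z \<and> list_le zs z (last zs)"
  by (induction zs) auto

lemma list_hull_segment:
  assumes "distinct (as @ zs @ bs)" "zs \<noteq> []"
  shows "list_hull (as @ zs @ bs) {hd zs, last zs} = set zs"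
proof (intro equalityI subsetI)
  fix z assume "z \<in> set zs"
  then show "z \<in> list_hull (as @ zs @ bs) {hd zs, last zs}"
    using list_le_hd_last[of z zs] assms(2) unfolding list_hull_def by (auto simp: list_le_append)
next
  fix z assume "z \<in> list_hull (as @ zs @ bs) {hd zs, last zs}"
  then obtain x y where "x \<in> set zs" "y \<in> set zs"
    "list_le (as @ zs @ bs) x z" "list_le (as @ zs @ bs) z y"
    using hd_in_set[OF assms(2)] last_in_set[OF assms(2)] unfolding list_hull_def by blast
  then show "z \<in> set zs" using assms(1) by (auto simp: list_le_append dest: list_le_in_set)
qed

section \<open>Convex combinations of midpoints of nested edges\<close>

text \<open>Barycentric coordinates determine the weights on a chain of nested edges. The operator
  \<open>cl\<close> maps an edge to the vertices between its end points, and the coordinate of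
  \<open>z\<close> collects the weights of the edges at \<open>z\<close>, each divided equally
  among its vertices. The vertices with positive coordinates lie in the hull of the outermost edge
  \<open>e\<close> of positive weight and contain its end points. As the coordinates agree, the
  outermost edges of both chains lie in each other's hull and thus coincide. Subtracting the
  smaller one of both weights of this edge preserves the agreement of the coordinates and removes
  the edge from at least one chain.\<close>

lemma chain_weights_unique:
  fixes cl :: "'a set \<Rightarrow> 'a set" and w w' :: "'a set \<Rightarrow> real"
  assumes E: "finite E" "\<And>e. e \<in> E \<Longrightarrow> finite e \<and> e \<noteq> {} \<and> e \<subseteq> cl e"
    and least: "\<And>e e'. e \<in> E \<Longrightarrow> e' \<in> E \<Longrightarrow> e \<subseteq> cl e' \<Longrightarrow> cl e \<subseteq> cl e'"
    and inj: "inj_on cl E"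
    and nonneg: "\<And>e. e \<in> E \<Longrightarrow> 0 \<le> w e" "\<And>e. e \<in> E \<Longrightarrow> 0 \<le> w' e"
    and chain: "\<And>e f. e \<in> E \<Longrightarrow> f \<in> E \<Longrightarrow> w e \<noteq> 0 \<Longrightarrow> w f \<noteq> 0 \<Longrightarrow> cl e \<subseteq> cl f \<or> cl f \<subseteq> cl e"
      "\<And>e f. e \<in> E \<Longrightarrow> f \<in> E \<Longrightarrow> w' e \<noteq> 0 \<Longrightarrow> w' f \<noteq> 0 \<Longrightarrow> cl e \<subseteq> cl f \<or> cl f \<subseteq> cl e"
    and coord: "\<And>z. (\<Sum>e | e \<in> E \<and> z \<in> e. w e / card e) = (\<Sum>e | e \<in> E \<and> z \<in> e. w' e / card e)"
    and e0: "e0 \<in> E"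
  shows "w e0 = w' e0"
proof -
  have "\<forall>e\<in>E. w e = w' e"
    using nonneg chain coord
  proof (induction "card {e \<in> E. w e \<noteq> 0} + card {e \<in> E. w' e \<noteq> 0}" arbitrary: w w' rule: less_induct)
    case less
    note nonneg = less.prems(1,2) and chain = less.prems(3,4) and coord = less.prems(5)
    define S where "S = (\<lambda>v :: 'a set \<Rightarrow> real. {e \<in> E. v e \<noteq> 0})"
    have fin: "finite (S v)" for v using E by (simp add: S_def)
    have support: "\<Union>(S v) = {z. (\<Sum>e | e \<in> E \<and> z \<in> e. v e / card e) \<noteq> 0}"
      if v: "\<And>e. e \<in> E \<Longrightarrow> 0 \<le> v e" for v :: "'a set \<Rightarrow> real"
    proof -
      have "(\<Sum>e | e \<in> E \<and> z \<in> e. v e / card e) = 0 \<longleftrightarrow> (\<forall>e\<in>E. z \<in> e \<longrightarrow> v e = 0)" for z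
        using E v by (subst sum_nonneg_eq_0_iff) auto
      then show ?thesis by (auto simp: S_def)
    qed
    have same: "\<Union>(S w) = \<Union>(S w')"
      using support[of w] support[of w'] nonneg coord by auto
    have top: "\<exists>e\<in>S v. \<forall>f\<in>S v. cl f \<subseteq> cl e"
      if ne: "S v \<noteq> {}" and tot: "\<And>e f. e \<in> E \<Longrightarrow> f \<in> E \<Longrightarrow> v e \<noteq> 0 \<Longrightarrow> v f \<noteq> 0 \<Longrightarrow> cl e \<subseteq> cl f \<or> cl f \<subseteq> cl e" for v
    proof -
      have "\<exists>e\<in>S v. \<forall>f\<in>S v. cl e \<subseteq> cl f \<longrightarrow> cl e = cl f"
        using finite_has_maximal[of "cl ` S v"] fin[of v] ne by auto
      then obtain e where e: "e \<in> S v" "\<And>f. f \<in> S v \<Longrightarrow> cl e \<subseteq> cl f \<Longrightarrow> cl e = cl f" by blast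
      have "cl f \<subseteq> cl e" if "f \<in> S v" for f
        using e(2)[OF that] tot[of e f] e(1) that by (auto simp: S_def)
      then show ?thesis using e(1) by blast
    qed
    show ?case
    proof (cases "S w = {}")
      case True
      then have "S w' = {}" using same E(2) unfolding S_def by fastforce
      then show ?thesis using True by (auto simp: S_def)
    next
      case False
      then have ne: "S w' \<noteq> {}" using same E(2) unfolding S_def by fastforce
      have "\<exists>e\<in>S w. \<forall>f\<in>S w. cl f \<subseteq> cl e" using False chain(1) by (rule top)
      then obtain e where e: "e \<in> S w" "\<forall>f\<in>S w. cl f \<subseteq> cl e" by blast
      have "\<exists>e\<in>S w'. \<forall>f\<in>S w'. cl f \<subseteq> cl e" using ne chain(2) by (rule top)
      then obtain e' where e': "e' \<in> S w'" "\<forall>f\<in>S w'. cl f \<subseteq> cl e'" by blast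
      have eE: "e \<in> E" "e' \<in> E" using e e' by (auto simp: S_def)
      have "f \<subseteq> cl f" if "f \<in> S v" for f v using that E(2) by (auto simp: S_def)
      then have "\<Union>(S w) \<subseteq> cl e" "\<Union>(S w') \<subseteq> cl e'" using e(2) e'(2) by blast+
      then have "e \<subseteq> cl e'" "e' \<subseteq> cl e" using e(1) e'(1) same by blast+
      then have "cl e = cl e'" using least eE by blast
      then have ee: "e' = e" using inj eE by (auto dest: inj_onD)
      \<comment> \<open>Peel off the common part of the two weights of the outermost edge.\<close>
      define m where "m = min (w e) (w' e)"
      define v where "v = w(e := w e - m)"
      define v' where "v' = w'(e := w' e - m)"
      have m: "0 < m" "m \<le> w e" "m \<le> w' e"
        using e e' ee nonneg eE by (auto simp: m_def S_def less_le)
      have sub: "S v \<subseteq> S w" "S v' \<subseteq> S w'"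
        using e e' ee by (auto simp: S_def v_def v'_def)
      have "e \<notin> S v \<or> e \<notin> S v'"
        by (auto simp: S_def v_def v'_def m_def)
      then have "S v \<subset> S w \<or> S v' \<subset> S w'" using sub e e' ee by blast
      then have smaller: "card (S v) + card (S v') < card (S w) + card (S w')"
        using card_mono[OF fin sub(1)] card_mono[OF fin sub(2)] psubset_card_mono[OF fin, of "S v" w]
          psubset_card_mono[OF fin, of "S v'" w'] by linarith
      have shift: "(\<Sum>f | f \<in> E \<and> z \<in> f. (u(e := u e - m)) f / card f)
          = (\<Sum>f | f \<in> E \<and> z \<in> f. u f / card f) - (if z \<in> e then m / card e else 0)"
        for u :: "'a set \<Rightarrow> real" and z
      proof -
        have "(\<Sum>f | f \<in> E \<and> z \<in> f. (u(e := u e - m)) f / card f)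
            = (\<Sum>f | f \<in> E \<and> z \<in> f. u f / card f - (if f = e then m / card e else 0))"
          by (intro sum.cong) (auto simp: diff_divide_distrib)
        also have "\<dots> = (\<Sum>f | f \<in> E \<and> z \<in> f. u f / card f)
            - (\<Sum>f | f \<in> E \<and> z \<in> f. if f = e then m / card e else 0)"
          by (rule sum_subtractf)
        also have "(\<Sum>f | f \<in> E \<and> z \<in> f. if f = e then m / card e else 0)
            = (if z \<in> e then m / card e else 0)"
          using E eE by (subst sum.delta) auto
        finally show ?thesis .
      qed
      have "\<forall>f\<in>E. v f = v' f"
      proof (rule less.hyps)
        show "card {e \<in> E. v e \<noteq> 0} + card {e \<in> E. v' e \<noteq> 0}
            < card {e \<in> E. w e \<noteq> 0} + card {e \<in> E. w' e \<noteq> 0}"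
          using smaller by (simp add: S_def)
        show "0 \<le> v f" "0 \<le> v' f" if "f \<in> E" for f
          using nonneg[OF that] m by (auto simp: v_def v'_def)
        show "cl f \<subseteq> cl g \<or> cl g \<subseteq> cl f" if "f \<in> E" "g \<in> E" "v f \<noteq> 0" "v g \<noteq> 0" for f g
        proof -
          have "f \<in> S w" "g \<in> S w" using sub(1) that by (auto simp: S_def)
          then show ?thesis using chain(1) by (simp add: S_def)
        qed
        show "cl f \<subseteq> cl g \<or> cl g \<subseteq> cl f" if "f \<in> E" "g \<in> E" "v' f \<noteq> 0" "v' g \<noteq> 0" for f g
        proof -
          have "f \<in> S w'" "g \<in> S w'" using sub(2) that by (auto simp: S_def)
          then show ?thesis using chain(2) by (simp add: S_def)
        qed
        show "(\<Sum>f | f \<in> E \<and> z \<in> f. v f / card f) = (\<Sum>f | f \<in> E \<and> z \<in> f. v' f / card f)" for z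
          unfolding v_def v'_def shift coord ..
      qed
      then show ?thesis
        unfolding v_def v'_def by (metis diff_add_cancel fun_upd_apply)
    qed
  qed
  then show ?thesis using e0 by blast
qed

definition barycenter :: "'a::real_vector set \<Rightarrow> 'a" where
  "barycenter e = (1 / real (card e)) *\<^sub>R \<Sum>e"

lemma affine_coords_unique:
  fixes a b :: "'a::real_vector \<Rightarrow> real"
  assumes "finite S" "\<not> affine_dependent S" "sum a S = sum b S"
    "(\<Sum>z\<in>S. a z *\<^sub>R z) = (\<Sum>z\<in>S. b z *\<^sub>R z)" "z \<in> S"
  shows "a z = b z"
proof (rule ccontr)
  assume "a z \<noteq> b z"
  then have "\<exists>U. sum U S = 0 \<and> (\<exists>v\<in>S. U v \<noteq> 0) \<and> (\<Sum>v\<in>S. U v *\<^sub>R v) = 0"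
    using assms by (intro exI[of _ "\<lambda>z. a z - b z"])
      (auto simp: sum_subtractf scaleR_left_diff_distrib)
  then show False using assms(2) affine_dependent_explicit_finite[OF assms(1)] by simp
qed

lemma barycenter_coords:
  fixes E :: "'a::real_vector set set"
  assumes "finite S" and E: "finite E" "\<And>e. e \<in> E \<Longrightarrow> e \<subseteq> S \<and> e \<noteq> {}"
  shows "(\<Sum>e\<in>E. w e *\<^sub>R barycenter e) = (\<Sum>z\<in>S. (\<Sum>e | e \<in> E \<and> z \<in> e. w e / card e) *\<^sub>R z)"
    and "(\<Sum>e\<in>E. w e) = (\<Sum>z\<in>S. \<Sum>e | e \<in> E \<and> z \<in> e. w e / card e)"
proof -
  have fin: "finite e" if "e \<in> E" for e using that assms finite_subset by blast
  have if_S: "{z \<in> S. z \<in> e} = e" if "e \<in> E" for e using that E by auto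
  have "(\<Sum>e\<in>E. w e *\<^sub>R barycenter e) = (\<Sum>e\<in>E. \<Sum>z | z \<in> S \<and> z \<in> e. (w e / card e) *\<^sub>R z)"
    by (intro sum.cong) (auto simp: barycenter_def scaleR_sum_right if_S)
  also have "\<dots> = (\<Sum>z\<in>S. \<Sum>e | e \<in> E \<and> z \<in> e. (w e / card e) *\<^sub>R z)"
    by (rule sum.swap_restrict[OF E(1) assms(1)])
  finally show "(\<Sum>e\<in>E. w e *\<^sub>R barycenter e) = (\<Sum>z\<in>S. (\<Sum>e | e \<in> E \<and> z \<in> e. w e / card e) *\<^sub>R z)"
    by (simp add: scaleR_sum_left)
  have "(\<Sum>e\<in>E. w e) = (\<Sum>e\<in>E. \<Sum>z | z \<in> S \<and> z \<in> e. w e / card e)"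
    using fin E by (intro sum.cong) (auto simp: if_S)
  also have "\<dots> = (\<Sum>z\<in>S. \<Sum>e | e \<in> E \<and> z \<in> e. w e / card e)"
    by (rule sum.swap_restrict[OF E(1) assms(1)])
  finally show "(\<Sum>e\<in>E. w e) = (\<Sum>z\<in>S. \<Sum>e | e \<in> E \<and> z \<in> e. w e / card e)" .
qed

lemma in_convex_hull_image:
  fixes g :: "'b \<Rightarrow> 'a::real_vector"
  assumes "finite E" "x \<in> convex hull (g ` E)"
  obtains w where "\<And>e. e \<in> E \<Longrightarrow> 0 \<le> w e" "sum w E = 1" "(\<Sum>e\<in>E. w e *\<^sub>R g e) = x"
proof -
  \<comment> \<open>Weights on the points of the image are pulled back to one preimage each.\<close>
  obtain D where D: "D \<subseteq> E" "inj_on g D" "g ` E = g ` D"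
    by (metis subset_image_inj order_refl)
  obtain u where u: "\<forall>p\<in>g ` D. 0 \<le> u p" "sum u (g ` D) = 1" "(\<Sum>p\<in>g ` D. u p *\<^sub>R p) = x"
    using assms(2) unfolding D(3) convex_hull_finite[OF finite_imageI[OF finite_subset[OF D(1) assms(1)]]]
    by blast
  define w where "w = (\<lambda>e. if e \<in> D then u (g e) else 0)"
  have "sum w E = sum (u \<circ> g) D"
    using assms(1) D(1) by (intro sum.mono_neutral_cong_right) (auto simp: w_def)
  then have "sum w E = 1" using u(2) sum.reindex[OF D(2), of u] by simp
  moreover have "(\<Sum>e\<in>E. w e *\<^sub>R g e) = (\<Sum>e\<in>D. u (g e) *\<^sub>R g e)"
    using assms(1) D(1) by (intro sum.mono_neutral_cong_right) (auto simp: w_def)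
  then have "(\<Sum>e\<in>E. w e *\<^sub>R g e) = x" using u(3) by (simp add: sum.reindex[OF D(2)])
  moreover have "0 \<le> w e" for e using u(1) by (simp add: w_def)
  ultimately show thesis using that by blast
qed

lemma convex_hull_image_subset_support:
  fixes g :: "'b \<Rightarrow> 'a::real_vector"
  assumes "finite E" "\<And>e. e \<in> E \<Longrightarrow> 0 \<le> w e" "sum w E = 1" "D \<subseteq> E" "\<And>e. e \<in> E - D \<Longrightarrow> w e = 0"
  shows "(\<Sum>e\<in>E. w e *\<^sub>R g e) \<in> convex hull (g ` D)"
proof -
  have "(\<Sum>e\<in>E. w e *\<^sub>R g e) = (\<Sum>e\<in>D. w e *\<^sub>R g e)" "sum w E = sum w D"
    using assms by (intro sum.mono_neutral_right; force)+
  moreover have "(\<Sum>e\<in>D. w e *\<^sub>R g e) \<in> convex hull (g ` D)"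
    using assms calculation finite_subset[OF assms(4,1)]
    by (intro convex_sum) (auto simp: hull_inc)
  ultimately show ?thesis by simp
qed

text \<open>If a convex combination of barycenters lies in the face spanned by \<open>F\<close>,
  its barycentric coordinates vanish at the other vertices. As weights are nonnegative, only sets
  inside the face can carry weight.\<close>

lemma common_face_coords:
  fixes S :: "'a::real_vector set"
  assumes S: "finite S" "\<not> affine_dependent S" and F: "F \<subseteq> S"
    and E: "finite E" "\<And>e. e \<in> E \<Longrightarrow> e \<subseteq> S \<and> e \<noteq> {}"
    and w: "\<And>e. e \<in> E \<Longrightarrow> 0 \<le> w e" "sum w E = 1" "(\<Sum>e\<in>E. w e *\<^sub>R barycenter e) = x"
    and s: "sum s F = 1" "(\<Sum>z\<in>F. s z *\<^sub>R z) = x"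
  shows "\<And>e. e \<in> E \<Longrightarrow> w e \<noteq> 0 \<Longrightarrow> e \<subseteq> F"
    and "\<And>z. (\<Sum>e | e \<in> E \<and> z \<in> e. w e / card e) = (if z \<in> F then s z else 0)"
proof -
  let ?t = "\<lambda>z. \<Sum>e | e \<in> E \<and> z \<in> e. w e / card e"
  let ?s = "\<lambda>z. if z \<in> F then s z else 0"
  have "sum ?s S = sum s F" "(\<Sum>z\<in>S. ?s z *\<^sub>R z) = (\<Sum>z\<in>F. s z *\<^sub>R z)"
    using S(1) F by (intro sum.mono_neutral_cong_right; force)+
  then have S_eq: "?t z = ?s z" if "z \<in> S" for z
    using affine_coords_unique[OF S, of ?t ?s z] barycenter_coords[OF S(1) E, where w = w] w s that
    by simp
  show coord: "?t z = ?s z" for z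
  proof (cases "z \<in> S")
    case False
    then have "{e. e \<in> E \<and> z \<in> e} = {}" using E(2) by blast
    then have "?t z = 0" by (simp only: sum.empty)
    then show ?thesis using False F by auto
  qed (rule S_eq)
  show "e \<subseteq> F" if e: "e \<in> E" "w e \<noteq> 0" for e
  proof
    fix z assume z: "z \<in> e"
    have "0 \<le> w e / card e" "w e / card e \<noteq> 0"
      using w e E(2)[OF e(1)] finite_subset[OF _ S(1), of e] by auto
    moreover have "w e / card e \<le> ?t z"
      using E(1) w e z by (intro member_le_sum) auto
    ultimately have "?t z \<noteq> 0" by linarith
    then show "z \<in> F" using coord[of z] by presburger
  qed
qed

text \<open>A common point of the two simplices of barycenters lies in the common face of the
  large simplices, so that on both sides only edges inside that face carry weight. Its coordinates
  with respect to the face are the same from both sides, and by uniqueness of the weights the two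
  combinations coincide. Therefore only edges that belong to both chains are involved. The
  conditions on \<open>cl\<close> are imposed on edges inside the common face only, because the
  vertex orders of the two simplices are unrelated elsewhere.\<close>

lemma chain_simplices_meet_in_common_face:
  fixes S1 S2 :: "'a::real_vector set" and cl :: "'a set \<Rightarrow> 'a set"
  assumes S1: "finite S1" "\<not> affine_dependent S1" and S2: "finite S2" "\<not> affine_dependent S2"
    and F: "F = S1 \<inter> S2" "convex hull S1 \<inter> convex hull S2 \<subseteq> convex hull F"
    and E1: "finite E1" "\<And>e. e \<in> E1 \<Longrightarrow> e \<subseteq> S1 \<and> e \<noteq> {}"
    and E2: "finite E2" "\<And>e. e \<in> E2 \<Longrightarrow> e \<subseteq> S2 \<and> e \<noteq> {}"
    and ext: "\<And>e. e \<in> E1 \<union> E2 \<Longrightarrow> e \<subseteq> F \<Longrightarrow> e \<subseteq> cl e"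
    and least: "\<And>e e'. e \<in> E1 \<union> E2 \<Longrightarrow> e' \<in> E1 \<union> E2 \<Longrightarrow> e \<subseteq> F \<Longrightarrow> e' \<subseteq> F \<Longrightarrow>
        e \<subseteq> cl e' \<Longrightarrow> cl e \<subseteq> cl e'"
    and inj: "inj_on cl {e \<in> E1 \<union> E2. e \<subseteq> F}"
    and chain1: "\<And>e e'. e \<in> E1 \<Longrightarrow> e' \<in> E1 \<Longrightarrow> e \<subseteq> F \<Longrightarrow> e' \<subseteq> F \<Longrightarrow>
        cl e \<subseteq> cl e' \<or> cl e' \<subseteq> cl e"
    and chain2: "\<And>e e'. e \<in> E2 \<Longrightarrow> e' \<in> E2 \<Longrightarrow> e \<subseteq> F \<Longrightarrow> e' \<subseteq> F \<Longrightarrow>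
        cl e \<subseteq> cl e' \<or> cl e' \<subseteq> cl e"
  shows "convex hull (barycenter ` E1) \<inter> convex hull (barycenter ` E2)
    \<subseteq> convex hull (barycenter ` (E1 \<inter> E2))"
proof
  fix x assume "x \<in> convex hull (barycenter ` E1) \<inter> convex hull (barycenter ` E2)"
  then have x: "x \<in> convex hull (barycenter ` E1)" "x \<in> convex hull (barycenter ` E2)" by auto
  obtain w1 where w1: "\<And>e. e \<in> E1 \<Longrightarrow> 0 \<le> w1 e" "sum w1 E1 = 1" "(\<Sum>e\<in>E1. w1 e *\<^sub>R barycenter e) = x"
    by (rule in_convex_hull_image[OF E1(1) x(1)]) blast
  obtain w2 where w2: "\<And>e. e \<in> E2 \<Longrightarrow> 0 \<le> w2 e" "sum w2 E2 = 1" "(\<Sum>e\<in>E2. w2 e *\<^sub>R barycenter e) = x"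
    by (rule in_convex_hull_image[OF E2(1) x(2)]) blast
  have in_hull: "barycenter e \<in> convex hull S" if "finite S" "e \<subseteq> S" "e \<noteq> {}" for e S :: "'a set"
  proof -
    have "(\<Sum>z\<in>e. (1 / card e) *\<^sub>R z) \<in> convex hull S"
      using that finite_subset[OF that(2,1)] by (intro convex_sum) (auto simp: hull_inc)
    then show ?thesis by (simp add: barycenter_def scaleR_sum_right)
  qed
  have "convex hull (barycenter ` E1) \<subseteq> convex hull S1" "convex hull (barycenter ` E2) \<subseteq> convex hull S2"
    using E1(2) E2(2) in_hull[OF S1(1)] in_hull[OF S2(1)]
    by (intro hull_minimal convex_convex_hull; blast)+
  then have "x \<in> convex hull F" using x F(2) by blast
  moreover have "finite F" using F(1) S1(1) by simp
  ultimately obtain s where s: "sum s F = 1" "(\<Sum>z\<in>F. s z *\<^sub>R z) = x"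
    by (auto simp: convex_hull_finite)
  have F12: "F \<subseteq> S1" "F \<subseteq> S2" using F(1) by auto
  note c1 = common_face_coords[OF S1 F12(1) E1 w1 s]
  note c2 = common_face_coords[OF S2 F12(2) E2 w2 s]
  define E where "E = {e \<in> E1 \<union> E2. e \<subseteq> F}"
  \<comment> \<open>Extending the weights by zero puts both combinations on the same set \<open>E\<close> of edges.\<close>
  define v1 where "v1 = (\<lambda>e. if e \<in> E1 then w1 e else 0)"
  define v2 where "v2 = (\<lambda>e. if e \<in> E2 then w2 e else 0)"
  have v1: "(\<Sum>e | e \<in> E \<and> z \<in> e. v1 e / card e) = (\<Sum>e | e \<in> E1 \<and> z \<in> e. w1 e / card e)" for z
  proof -
    have "(\<Sum>e | e \<in> E \<and> z \<in> e. v1 e / card e) = (\<Sum>e | e \<in> E1 \<union> E2 \<and> z \<in> e. v1 e / card e)"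
      using E1(1) E2(1) c1(1) by (intro sum.mono_neutral_left) (auto simp: E_def v1_def)
    also have "\<dots> = (\<Sum>e | e \<in> E1 \<and> z \<in> e. w1 e / card e)"
      using E1(1) E2(1) by (intro sum.mono_neutral_cong_right) (auto simp: v1_def)
    finally show ?thesis .
  qed
  have v2: "(\<Sum>e | e \<in> E \<and> z \<in> e. v2 e / card e) = (\<Sum>e | e \<in> E2 \<and> z \<in> e. w2 e / card e)" for z
  proof -
    have "(\<Sum>e | e \<in> E \<and> z \<in> e. v2 e / card e) = (\<Sum>e | e \<in> E1 \<union> E2 \<and> z \<in> e. v2 e / card e)"
      using E1(1) E2(1) c2(1) by (intro sum.mono_neutral_left) (auto simp: E_def v2_def)
    also have "\<dots> = (\<Sum>e | e \<in> E2 \<and> z \<in> e. w2 e / card e)"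
      using E1(1) E2(1) by (intro sum.mono_neutral_cong_right) (auto simp: v2_def)
    finally show ?thesis .
  qed
  have v_eq: "v1 e = v2 e" if "e \<in> E" for e
  proof (rule chain_weights_unique[where cl = cl and E = E])
    show "finite E" using E1(1) E2(1) by (simp add: E_def)
    show "finite f \<and> f \<noteq> {} \<and> f \<subseteq> cl f" if "f \<in> E" for f
      using that E1(2) E2(2) ext S1(1) S2(1) finite_subset \<open>finite F\<close> unfolding E_def by blast
    show "cl f \<subseteq> cl g" if "f \<in> E" "g \<in> E" "f \<subseteq> cl g" for f g
      using that least[of f g] unfolding E_def by blast
    show "inj_on cl E" using inj by (simp add: E_def)
    show "0 \<le> v1 f" "0 \<le> v2 f" for f using w1(1) w2(1) by (auto simp: v1_def v2_def)
    show "cl f \<subseteq> cl g \<or> cl g \<subseteq> cl f" if "f \<in> E" "g \<in> E" "v1 f \<noteq> 0" "v1 g \<noteq> 0" for f g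
      using that chain1[of f g] by (auto simp: E_def v1_def split: if_splits)
    show "cl f \<subseteq> cl g \<or> cl g \<subseteq> cl f" if "f \<in> E" "g \<in> E" "v2 f \<noteq> 0" "v2 g \<noteq> 0" for f g
      using that chain2[of f g] by (auto simp: E_def v2_def split: if_splits)
    show "(\<Sum>f | f \<in> E \<and> z \<in> f. v1 f / card f) = (\<Sum>f | f \<in> E \<and> z \<in> f. v2 f / card f)" for z
      using c1(2)[of z] c2(2)[of z] v1[of z] v2[of z] by linarith
  qed (rule that)
  have "w1 e = 0" if e: "e \<in> E1 - E1 \<inter> E2" for e
  proof (rule ccontr)
    assume "w1 e \<noteq> 0"
    then have "e \<in> E" using c1(1) e by (auto simp: E_def)
    from v_eq[OF this] \<open>w1 e \<noteq> 0\<close> e show False by (simp add: v1_def v2_def)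
  qed
  then show "x \<in> convex hull (barycenter ` (E1 \<inter> E2))"
    using convex_hull_image_subset_support[OF E1(1) w1(1,2), of "E1 \<inter> E2" barycenter] w1(3) by simp
qed

section \<open>Subdivision of a simplex along chains of segments\<close>

text \<open>Maximal chains of nested contiguous segments of a list, from a single element up to
  the whole list. In passing to the next smaller segment, the last or the first element is
  dropped.\<close>

inductive segment_chain :: "'a list \<Rightarrow> 'a list list \<Rightarrow> bool" where
  single: "segment_chain [x] [[x]]"
| butlast: "2 \<le> length zs \<Longrightarrow> segment_chain (butlast zs) c \<Longrightarrow> segment_chain zs (c @ [zs])"
| tl: "2 \<le> length zs \<Longrightarrow> segment_chain (tl zs) c \<Longrightarrow> segment_chain zs (c @ [zs])"

definition ends :: "'a list \<Rightarrow> 'a set" where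
  "ends zs = {hd zs, last zs}"

definition end_midpoint :: "'a::real_vector list \<Rightarrow> 'a" where
  "end_midpoint zs = midpoint (hd zs) (last zs)"

lemma end_midpoint_eq_barycenter: "end_midpoint zs = barycenter (ends zs)"
  by (auto simp: end_midpoint_def barycenter_def ends_def midpoint_def card_insert_if
      simp flip: scaleR_2)

lemma length_segment_chain: "segment_chain xs c \<Longrightarrow> length c = length xs"
  by (induction rule: segment_chain.induct) auto

lemma last_segment_chain: "segment_chain xs c \<Longrightarrow> c \<noteq> [] \<and> last c = xs"
  by (induction rule: segment_chain.induct) auto

lemma segment_chain_segments:
  "segment_chain xs c \<Longrightarrow> zs \<in> set c \<Longrightarrow> zs \<noteq> [] \<and> (\<exists>as bs. xs = as @ zs @ bs)"
proof (induction rule: segment_chain.induct)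
  case (butlast xs c)
  have xs: "xs = butlast xs @ [last xs]" using butlast.hyps(1) by (cases xs) auto
  show ?case
  proof (cases "zs = xs")
    case True
    then show ?thesis using butlast.hyps(1) by (metis append_Nil append_Nil2 list.size(3) not_numeral_le_zero)
  next
    case False
    then obtain as bs where "zs \<noteq> []" "butlast xs = as @ zs @ bs" using butlast by auto
    then have "xs = as @ zs @ (bs @ [last xs])" using xs by (metis append.assoc)
    then show ?thesis using \<open>zs \<noteq> []\<close> by blast
  qed
next
  case (tl xs c)
  have xs: "xs = hd xs # tl xs" using tl.hyps(1) by (cases xs) auto
  show ?case
  proof (cases "zs = xs")
    case True
    then show ?thesis using tl.hyps(1) by (metis append_Nil append_Nil2 list.size(3) not_numeral_le_zero)
  next
    case False
    then obtain as bs where "zs \<noteq> []" "tl xs = as @ zs @ bs" using tl by auto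
    then have "xs = (hd xs # as) @ zs @ bs" using xs by (metis append_Cons)
    then show ?thesis using \<open>zs \<noteq> []\<close> by blast
  qed
qed auto

lemma set_butlast_psubset: "distinct zs \<Longrightarrow> 2 \<le> length zs \<Longrightarrow> set (butlast zs) \<subset> set zs"
  by (cases zs rule: rev_cases) auto

lemma set_tl_psubset: "distinct zs \<Longrightarrow> 2 \<le> length zs \<Longrightarrow> set (tl zs) \<subset> set zs"
  by (cases zs) auto

lemma segment_chain_sorted:
  "segment_chain xs c \<Longrightarrow> distinct xs \<Longrightarrow> sorted_wrt (\<lambda>a b. set a \<subset> set b) c"
proof (induction rule: segment_chain.induct)
  case (butlast xs c)
  have "set zs \<subset> set xs" if "zs \<in> set c" for zs
    using segment_chain_segments[OF butlast.hyps(2) that] set_butlast_psubset[OF butlast.prems butlast.hyps(1)]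
    by auto
  then show ?case using butlast by (auto simp: sorted_wrt_append distinct_butlast)
next
  case (tl xs c)
  have "set zs \<subset> set xs" if "zs \<in> set c" for zs
    using segment_chain_segments[OF tl.hyps(2) that] set_tl_psubset[OF tl.prems tl.hyps(1)]
    by auto
  then show ?case using tl by (auto simp: sorted_wrt_append distinct_tl)
qed auto

lemma end_midpoint_in_convex_hull: "zs \<noteq> [] \<Longrightarrow> end_midpoint zs \<in> convex hull (set zs)"
proof -
  assume "zs \<noteq> []"
  then have "hd zs \<in> convex hull (set zs)" "last zs \<in> convex hull (set zs)"
    by (auto intro: hull_inc)
  then have "closed_segment (hd zs) (last zs) \<subseteq> convex hull (set zs)"
    by (intro closed_segment_subset_convex_hull)
  then show ?thesis by (auto simp: end_midpoint_def)
qed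

lemma end_midpoints_in_convex_hull:
  assumes "segment_chain xs c"
  shows "end_midpoint ` set c \<subseteq> convex hull (set xs)"
proof clarify
  fix zs assume "zs \<in> set c"
  then obtain as bs where "zs \<noteq> []" "xs = as @ zs @ bs"
    using segment_chain_segments[OF assms] by blast
  then show "end_midpoint zs \<in> convex hull (set xs)"
    using end_midpoint_in_convex_hull[of zs] hull_mono[of "set zs" "set xs" convex] by auto
qed

lemma midpoint_in_affine_iff:
  assumes "affine A" "x \<in> A" "midpoint x y \<in> A"
  shows "y \<in> A"
proof -
  have "(-1) *\<^sub>R x + 2 *\<^sub>R midpoint x y \<in> A"
    by (rule mem_affine[OF assms]) simp
  then show ?thesis by (simp add: midpoint_def)
qed

lemma affine_independent_notin_hull:
  assumes "\<not> affine_dependent S" "x \<in> S" "A \<subseteq> S - {x}"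
  shows "x \<notin> affine hull A"
  using assms hull_mono[OF assms(3), of affine] unfolding affine_dependent_def by blast

text \<open>In the chain for \<open>butlast xs\<close> all midpoints lie in the affine hull of
  \<open>butlast xs\<close>. The midpoint of the ends of \<open>xs\<close> does not, since
  otherwise the last vertex would; the case of \<open>tl xs\<close> is symmetric.\<close>

lemma segment_chain_independent:
  fixes xs :: "'a::euclidean_space list"
  shows "segment_chain xs c \<Longrightarrow> distinct xs \<Longrightarrow> \<not> affine_dependent (set xs) \<Longrightarrow>
    \<not> affine_dependent (end_midpoint ` set c) \<and> distinct (map end_midpoint c)"
proof (induction rule: segment_chain.induct)
  case (butlast xs c)
  have ne: "butlast xs \<noteq> []" using butlast.hyps(1) by (cases xs) auto
  have sub: "set (butlast xs) \<subseteq> set xs - {last xs}"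
    using butlast.prems(1) by (cases xs rule: rev_cases) auto
  have IH: "\<not> affine_dependent (end_midpoint ` set c)" "distinct (map end_midpoint c)"
    using butlast.IH butlast.prems distinct_butlast affine_dependent_subset[of "set (butlast xs)" "set xs"] sub
    by blast+
  have "last xs \<notin> affine hull (set (butlast xs))"
    using affine_independent_notin_hull[OF butlast.prems(2) _ sub] ne by (cases xs) auto
  moreover have "hd xs \<in> affine hull (set (butlast xs))"
    using ne butlast.hyps(1) by (intro hull_inc) (cases xs; auto)
  ultimately have "end_midpoint xs \<notin> affine hull (set (butlast xs))"
    using midpoint_in_affine_iff[OF affine_affine_hull] unfolding end_midpoint_def by blast
  then have notin: "end_midpoint xs \<notin> affine hull (end_midpoint ` set c)"
    using end_midpoints_in_convex_hull[OF butlast.hyps(2)] convex_hull_subset_affine_hull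
    by (metis hull_minimal affine_affine_hull subset_eq subset_trans)
  show ?case
    using IH affine_independent_insert[OF IH(1) notin] notin hull_inc[of "end_midpoint xs" "end_midpoint ` set c" affine]
    by auto
next
  case (tl xs c)
  have ne: "tl xs \<noteq> []" using tl.hyps(1) by (cases xs) auto
  have sub: "set (tl xs) \<subseteq> set xs - {hd xs}"
    using tl.prems(1) by (cases xs) auto
  have IH: "\<not> affine_dependent (end_midpoint ` set c)" "distinct (map end_midpoint c)"
    using tl.IH tl.prems distinct_tl affine_dependent_subset[of "set (tl xs)" "set xs"] sub
    by blast+
  have "hd xs \<notin> affine hull (set (tl xs))"
    using affine_independent_notin_hull[OF tl.prems(2) _ sub] ne by (cases xs) auto
  moreover have "last xs \<in> affine hull (set (tl xs))"
    using ne by (metis hull_inc last_in_set last_tl)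
  ultimately have "end_midpoint xs \<notin> affine hull (set (tl xs))"
    using midpoint_in_affine_iff[OF affine_affine_hull, of "last xs" _ "hd xs"]
    unfolding end_midpoint_def by (metis midpoint_sym)
  then have notin: "end_midpoint xs \<notin> affine hull (end_midpoint ` set c)"
    using end_midpoints_in_convex_hull[OF tl.hyps(2)] convex_hull_subset_affine_hull
    by (metis hull_minimal affine_affine_hull subset_eq subset_trans)
  show ?case
    using IH affine_independent_insert[OF IH(1) notin] notin hull_inc[of "end_midpoint xs" "end_midpoint ` set c" affine]
    by auto
qed auto

lemma sorted_wrt_unique:
  assumes "sorted_wrt R xs" "sorted_wrt R ys" "set xs = set ys"
    and asym: "\<And>x y. R x y \<Longrightarrow> \<not> R y x"
  shows "xs = ys"
  using assms(1-3)
proof (induction xs arbitrary: ys)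
  case (Cons x xs)
  then obtain y ys' where ys: "ys = y # ys'" by (cases ys) auto
  have "x = y"
  proof (rule ccontr)
    assume "x \<noteq> y"
    then have "x \<in> set ys'" "y \<in> set xs" using Cons.prems(3) unfolding ys by auto
    then have "R y x" "R x y" using Cons.prems(1,2) unfolding ys by auto
    then show False using asym by blast
  qed
  moreover have "\<not> R x x" "\<not> R y y" using asym by blast+
  then have "x \<notin> set xs" "y \<notin> set ys'" using Cons.prems(1,2) unfolding ys by auto
  ultimately have "set xs = set ys'" using Cons.prems(3) unfolding ys by auto
  then show ?case using Cons \<open>x = y\<close> unfolding ys by auto
qed simp

text \<open>The hypotheses on a pair of elements, which may be equal, that uniform refinement
  passes on to the subsimplices.\<close>

definition compatible_simplices :: "'a::euclidean_space list \<Rightarrow> 'a list \<Rightarrow> bool" where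
  "compatible_simplices xs ys \<longleftrightarrow>
     distinct xs \<and> distinct ys \<and> \<not> affine_dependent (set xs) \<and> \<not> affine_dependent (set ys) \<and>
     convex hull (set xs) \<inter> convex hull (set ys) \<subseteq> convex hull (set xs \<inter> set ys) \<and>
     (let common = (\<lambda>x. x \<in> set xs \<inter> set ys) in
        filter common xs = filter common ys \<or> filter common xs = rev (filter common ys))"

text \<open>Seen from the common face, both vertex lists induce the same hulls, whether the orders
  agree or are reversed.\<close>

lemma compatible_common_hull:
  assumes "compatible_simplices xs ys" "e \<subseteq> set xs \<inter> set ys"
  shows "list_hull xs e \<inter> (set xs \<inter> set ys) = list_hull ys e \<inter> (set xs \<inter> set ys)"
  using assms list_hull_filter[OF assms(2), of xs] list_hull_filter[OF assms(2), of ys]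
  by (auto simp: compatible_simplices_def Let_def list_hull_rev)

lemma list_hull_ends:
  assumes "segment_chain xs c" "distinct xs" "zs \<in> set c"
  shows "list_hull xs (ends zs) = set zs"
  using segment_chain_segments[OF assms(1,3)] list_hull_segment assms(2) unfolding ends_def by blast

lemma ends_props:
  assumes "segment_chain xs c" "zs \<in> set c"
  shows "ends zs \<subseteq> set xs" "ends zs \<noteq> {}" "card (ends zs) \<le> 2"
  using segment_chain_segments[OF assms] by (auto simp: ends_def card_insert_if)

text \<open>Stated for subchains, because single edges are of interest as well: for these it says
  that different edges have different midpoints, even across two simplices.\<close>

lemma subchains_meet:
  assumes comp: "compatible_simplices xs ys" and c: "segment_chain xs c" and d: "segment_chain ys d"
    and C: "C \<subseteq> set c" and D: "D \<subseteq> set d"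
  shows "convex hull (end_midpoint ` C) \<inter> convex hull (end_midpoint ` D)
    \<subseteq> convex hull (barycenter ` (ends ` C \<inter> ends ` D))"
proof -
  define F where "F = set xs \<inter> set ys"
  define cl where "cl = list_hull (filter (\<lambda>x. x \<in> F) xs)"
  have xs: "distinct xs" "\<not> affine_dependent (set xs)" and ys: "distinct ys" "\<not> affine_dependent (set ys)"
    and meet: "convex hull (set xs) \<inter> convex hull (set ys) \<subseteq> convex hull F"
    using comp by (auto simp: compatible_simplices_def F_def)
  have F: "set (filter (\<lambda>x. x \<in> F) xs) = F" by (auto simp: F_def)
  have cl_c: "cl (ends a) = set a \<inter> F" if "a \<in> C" "ends a \<subseteq> F" for a
    using list_hull_ends[OF c xs(1), of a] that C list_hull_filter[of "ends a" F xs]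
    by (auto simp: cl_def)
  have cl_d: "cl (ends a) = set a \<inter> F" if "a \<in> D" "ends a \<subseteq> F" for a
    using list_hull_ends[OF d ys(1), of a] that D list_hull_filter[of "ends a" F xs]
      compatible_common_hull[OF comp, of "ends a"]
    by (auto simp: cl_def F_def)
  have nested: "set a \<subseteq> set b \<or> set b \<subseteq> set a"
    if g: "segment_chain us g" "distinct us" and ab: "a \<in> set g" "b \<in> set g" for us g a b
  proof -
    obtain i j where "a = g ! i" "b = g ! j" "i < length g" "j < length g"
      using ab unfolding in_set_conv_nth by blast
    then show ?thesis
      using sorted_wrt_nth_less[OF segment_chain_sorted[OF g], of i j]
        sorted_wrt_nth_less[OF segment_chain_sorted[OF g], of j i]
      by (cases i j rule: linorder_cases) auto
  qed
  have props: "e \<noteq> {} \<and> card e \<le> 2" if "e \<in> ends ` C \<union> ends ` D" for e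
    using that ends_props(2,3)[OF c] ends_props(2,3)[OF d] subsetD[OF C] subsetD[OF D] by (elim UnE imageE) simp_all
  have "convex hull (barycenter ` ends ` C) \<inter> convex hull (barycenter ` ends ` D)
    \<subseteq> convex hull (barycenter ` (ends ` C \<inter> ends ` D))"
  proof (rule chain_simplices_meet_in_common_face[where cl = cl and ?S1.0 = "set xs" and ?S2.0 = "set ys" and F = F])
    show "finite (ends ` C)" "finite (ends ` D)" using C D finite_subset by blast+
    show "e \<subseteq> set xs \<and> e \<noteq> {}" if "e \<in> ends ` C" for e using that ends_props[OF c] C by blast
    show "e \<subseteq> set ys \<and> e \<noteq> {}" if "e \<in> ends ` D" for e using that ends_props[OF d] D by blast
    show "e \<subseteq> cl e" if "e \<subseteq> F" for e
      unfolding cl_def using that F by (intro subset_list_hull) simp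
    show "cl e \<subseteq> cl e'" if "e \<subseteq> cl e'" for e e'
      using that xs(1) unfolding cl_def by (intro list_hull_least) auto
    show "inj_on cl {e \<in> ends ` C \<union> ends ` D. e \<subseteq> F}"
    proof (rule inj_onI)
      fix e e' assume e: "e \<in> {e \<in> ends ` C \<union> ends ` D. e \<subseteq> F}" and e': "e' \<in> {e \<in> ends ` C \<union> ends ` D. e \<subseteq> F}"
        and eq: "cl e = cl e'"
      show "e = e'"
        using list_hull_inject[of "filter (\<lambda>x. x \<in> F) xs" e e'] xs(1) e e' props F eq
        unfolding cl_def by auto
    qed
    show "cl e \<subseteq> cl e' \<or> cl e' \<subseteq> cl e" if "e \<in> ends ` C" "e' \<in> ends ` C" "e \<subseteq> F" "e' \<subseteq> F" for e e'
    proof -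
      obtain a a' where "e = ends a" "e' = ends a'" "a \<in> C" "a' \<in> C" using \<open>e \<in> _\<close> \<open>e' \<in> _\<close> by blast
      then show ?thesis
        using nested[OF c xs(1), of a a'] C cl_c \<open>e \<subseteq> F\<close> \<open>e' \<subseteq> F\<close> by auto
    qed
    show "cl e \<subseteq> cl e' \<or> cl e' \<subseteq> cl e" if "e \<in> ends ` D" "e' \<in> ends ` D" "e \<subseteq> F" "e' \<subseteq> F" for e e'
    proof -
      obtain a a' where "e = ends a" "e' = ends a'" "a \<in> D" "a' \<in> D" using \<open>e \<in> _\<close> \<open>e' \<in> _\<close> by blast
      then show ?thesis
        using nested[OF d ys(1), of a a'] D cl_d \<open>e \<subseteq> F\<close> \<open>e' \<subseteq> F\<close> by auto
    qed
  qed (use xs ys meet F_def in auto)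
  then show ?thesis by (simp add: image_image end_midpoint_eq_barycenter)
qed

lemma ends_eq_if_end_midpoint_eq:
  assumes "compatible_simplices xs ys" "segment_chain xs c" "segment_chain ys d"
    and "a \<in> set c" "b \<in> set d" "end_midpoint a = end_midpoint b"
  shows "ends a = ends b"
proof (rule ccontr)
  assume "ends a \<noteq> ends b"
  then show False using subchains_meet[OF assms(1-3), of "{a}" "{b}"] assms(4-6) by simp
qed

text \<open>Both lists are sorted by inclusion of segments. On the common midpoints, inclusion of
  segments means inclusion of the hulls of their ends in the common face, and these hulls are the
  same from both sides. So both restrictions are sorted with respect to the same asymmetric
  relation.\<close>

lemma segment_chains_common_order:
  assumes comp: "compatible_simplices xs ys" and c: "segment_chain xs c" and d: "segment_chain ys d"
  shows "filter (\<lambda>p. p \<in> end_midpoint ` set c \<inter> end_midpoint ` set d) (map end_midpoint c)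
       = filter (\<lambda>p. p \<in> end_midpoint ` set c \<inter> end_midpoint ` set d) (map end_midpoint d)"
proof -
  define F where "F = set xs \<inter> set ys"
  define P where "P = end_midpoint ` set c \<inter> end_midpoint ` set d"
  \<comment> \<open>The order on midpoints in the common face, read off from \<open>xs\<close>.\<close>
  define R where "R = (\<lambda>p q. \<exists>a\<in>set c. \<exists>a'\<in>set c. p = end_midpoint a \<and> q = end_midpoint a' \<and>
      list_hull xs (ends a) \<inter> F \<subset> list_hull xs (ends a') \<inter> F)"
  have dist: "distinct xs" "distinct ys" using comp by (auto simp: compatible_simplices_def)
  have self: "compatible_simplices xs xs"
    using comp by (auto simp: compatible_simplices_def)
  have asym: "\<not> R q p" if "R p q" for p q
  proof
    assume "R q p"
    then obtain b b' where b: "b \<in> set c" "b' \<in> set c" "q = end_midpoint b" "p = end_midpoint b'"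
      "list_hull xs (ends b) \<inter> F \<subset> list_hull xs (ends b') \<inter> F" by (auto simp: R_def)
    obtain a a' where a: "a \<in> set c" "a' \<in> set c" "p = end_midpoint a" "q = end_midpoint a'"
      "list_hull xs (ends a) \<inter> F \<subset> list_hull xs (ends a') \<inter> F" using \<open>R p q\<close> by (auto simp: R_def)
    have "ends a = ends b'" "ends a' = ends b"
      using ends_eq_if_end_midpoint_eq[OF self c c] a b by metis+
    then show False using a b by auto
  qed
  have hull_inj: "e = e'" if "e \<subseteq> F" "e' \<subseteq> F" "e \<noteq> {}" "e' \<noteq> {}" "card e \<le> 2" "card e' \<le> 2"
    "list_hull xs e \<inter> F = list_hull xs e' \<inter> F" for e e'
  proof -
    have F: "set (filter (\<lambda>x. x \<in> F) xs) = F" by (auto simp: F_def)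
    have "list_hull (filter (\<lambda>x. x \<in> F) xs) e = list_hull (filter (\<lambda>x. x \<in> F) xs) e'"
      using that list_hull_filter by metis
    then show ?thesis
      using list_hull_inject[of "filter (\<lambda>x. x \<in> F) xs" e e'] that dist F by simp
  qed
  have ends_F: "ends a = ends b \<and> ends a \<subseteq> F" if "a \<in> set c" "b \<in> set d" "end_midpoint a = end_midpoint b" for a b
    using ends_eq_if_end_midpoint_eq[OF comp c d that] ends_props[OF c that(1)] ends_props[OF d that(2)]
    by (auto simp: F_def)
  have R_c: "R (end_midpoint a) (end_midpoint a')" if "a \<in> set c" "a' \<in> set c" "set a \<subset> set a'" "end_midpoint a \<in> P" "end_midpoint a' \<in> P" for a a'
  proof -
    have e: "ends a \<subseteq> F" "ends a' \<subseteq> F" using ends_F that unfolding P_def by blast+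
    have "ends a \<noteq> ends a'" using that list_hull_ends[OF c dist(1)] by (metis psubset_eq)
    then have "list_hull xs (ends a) \<inter> F \<noteq> list_hull xs (ends a') \<inter> F"
      using hull_inj e ends_props[OF c] that by metis
    then have "list_hull xs (ends a) \<inter> F \<subset> list_hull xs (ends a') \<inter> F"
      using that list_hull_ends[OF c dist(1)] by auto
    then show ?thesis using that unfolding R_def by blast
  qed
  have R_d: "R (end_midpoint b) (end_midpoint b')" if b: "b \<in> set d" "b' \<in> set d" "set b \<subset> set b'" "end_midpoint b \<in> P" "end_midpoint b' \<in> P" for b b'
  proof -
    obtain a a' where a: "a \<in> set c" "end_midpoint a = end_midpoint b" "a' \<in> set c" "end_midpoint a' = end_midpoint b'"
      using b unfolding P_def by (metis IntD1 imageE)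
    then have e: "ends a = ends b" "ends a \<subseteq> F" "ends a' = ends b'" "ends a' \<subseteq> F"
      using ends_F b by blast+
    have "ends b \<noteq> ends b'" using b list_hull_ends[OF d dist(2)] by (metis psubset_eq)
    then have "list_hull xs (ends a) \<inter> F \<noteq> list_hull xs (ends a') \<inter> F"
      using hull_inj[of "ends a" "ends a'"] e ends_props[OF c] a by metis
    moreover have "list_hull xs (ends a) \<inter> F = set b \<inter> F" "list_hull xs (ends a') \<inter> F = set b' \<inter> F"
      using compatible_common_hull[OF comp] e list_hull_ends[OF d dist(2)] b unfolding F_def by metis+
    ultimately have "list_hull xs (ends a) \<inter> F \<subset> list_hull xs (ends a') \<inter> F"
      using b(3) by auto
    then show ?thesis using a unfolding R_def by metis
  qed
  have sorted: "sorted_wrt R (filter (\<lambda>p. p \<in> P) (map end_midpoint g))"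
    if "sorted_wrt (\<lambda>a b. set a \<subset> set b) g"
      "\<And>a b. a \<in> set g \<Longrightarrow> b \<in> set g \<Longrightarrow> set a \<subset> set b \<Longrightarrow> end_midpoint a \<in> P \<Longrightarrow> end_midpoint b \<in> P \<Longrightarrow> R (end_midpoint a) (end_midpoint b)" for g
    using that by (induction g) auto
  have "filter (\<lambda>p. p \<in> P) (map end_midpoint c) = filter (\<lambda>p. p \<in> P) (map end_midpoint d)"
  proof (rule sorted_wrt_unique[where R = R])
    show "sorted_wrt R (filter (\<lambda>p. p \<in> P) (map end_midpoint c))"
      using sorted[OF segment_chain_sorted[OF c dist(1)]] R_c by blast
    show "sorted_wrt R (filter (\<lambda>p. p \<in> P) (map end_midpoint d))"
      using sorted[OF segment_chain_sorted[OF d dist(2)]] R_d by blast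
    show "set (filter (\<lambda>p. p \<in> P) (map end_midpoint c)) = set (filter (\<lambda>p. p \<in> P) (map end_midpoint d))"
      by (auto simp: P_def)
  qed (rule asym)
  then show ?thesis by (simp add: P_def)
qed

text \<open>Even if the original simplices list their common vertices in reversed orders, the
  orders of the subsimplices agree, because inclusion of segments does not depend on the direction
  of the list.\<close>

lemma compatible_segment_chains:
  assumes comp: "compatible_simplices xs ys" and c: "segment_chain xs c" and d: "segment_chain ys d"
  shows "compatible_simplices (map end_midpoint c) (map end_midpoint d)"
proof -
  have "barycenter ` (ends ` set c \<inter> ends ` set d) \<subseteq> end_midpoint ` set c \<inter> end_midpoint ` set d"
    by (auto simp: end_midpoint_eq_barycenter)
  then have "convex hull (end_midpoint ` set c) \<inter> convex hull (end_midpoint ` set d) \<subseteq> convex hull (end_midpoint ` set c \<inter> end_midpoint ` set d)"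
    using subchains_meet[OF comp c d subset_refl subset_refl] hull_mono by (metis subset_trans)
  then show ?thesis
    using segment_chain_independent[OF c] segment_chain_independent[OF d]
      segment_chains_common_order[OF comp c d] comp
    by (simp add: compatible_simplices_def Let_def)
qed

section \<open>Uniform refinement of compatible meshes\<close>

definition bisect_all :: "'n::finite mesh \<Rightarrow> 'n mesh" where
  "bisect_all \<A> = \<Union>(children ` \<A>)"

definition uniform_refinement :: "'n::finite mesh \<Rightarrow> 'n mesh" where
  "uniform_refinement \<V> = {(map end_midpoint c, CARD('n)) | c. \<exists>T\<in>\<V>. segment_chain (fst T) c}"

text \<open>The conditions on an initial triangulation except for covering the domain. Conformity
  enters through \<open>compatible_simplices\<close>.\<close>

definition compatible_mesh :: "'n::finite mesh \<Rightarrow> bool" where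
  "compatible_mesh \<V> \<longleftrightarrow> finite \<V> \<and> inj_on verts \<V> \<and>
     (\<forall>T\<in>\<V>. length (fst T) = CARD('n) + 1 \<and> snd T = CARD('n)) \<and>
     (\<forall>T\<in>\<V>. \<forall>T'\<in>\<V>. compatible_simplices (fst T) (fst T'))"

text \<open>The shape of every descendant of an initial element, for which \<open>children\<close>
  never indexes beyond the end of the vertex list.\<close>

definition well_tagged :: "'n::finite tsimplex \<Rightarrow> bool" where
  "well_tagged T \<longleftrightarrow> length (fst T) = CARD('n) + 1 \<and> 1 \<le> snd T \<and> snd T \<le> CARD('n)"

lemma bisect_all_pow_Union:
  "(bisect_all ^^ k) \<A> = (\<Union>T\<in>\<A>. (bisect_all ^^ k) {T})"
proof (induction k)
  case (Suc k)
  have "bisect_all (\<Union>T\<in>\<A>. \<B> T) = (\<Union>T\<in>\<A>. bisect_all (\<B> T))" for \<B> :: "_ \<Rightarrow> 'a mesh"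
    by (auto simp: bisect_all_def)
  then show ?case using Suc by simp
qed auto

lemma finite_children: "finite (children T)" and card_children: "card (children T) \<le> 2"
  by (auto simp: children_def Let_def card_insert_if split: prod.splits)

lemma bisect_all_finite_card:
  assumes "finite \<A>"
  shows "finite (bisect_all \<A>) \<and> card (bisect_all \<A>) \<le> 2 * card \<A>"
proof
  show "finite (bisect_all \<A>)" using assms finite_children by (auto simp: bisect_all_def)
  have "card (bisect_all \<A>) \<le> (\<Sum>T\<in>\<A>. card (children T))"
    unfolding bisect_all_def using assms by (rule card_UN_le)
  also have "\<dots> \<le> (\<Sum>T\<in>\<A>. 2)" by (intro sum_mono card_children)
  finally show "card (bisect_all \<A>) \<le> 2 * card \<A>" by simp
qed

lemma bisect_all_pow_finite_card:
  assumes "finite \<A>"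
  shows "finite ((bisect_all ^^ k) \<A>) \<and> card ((bisect_all ^^ k) \<A>) \<le> 2 ^ k * card \<A>"
proof (induction k)
  case (Suc k)
  then show ?case using bisect_all_finite_card[of "(bisect_all ^^ k) \<A>"] by auto
qed (use assms in simp)

lemma segment_chain_iff:
  assumes "2 \<le> length zs"
  shows "segment_chain zs d \<longleftrightarrow> (\<exists>c. d = c @ [zs] \<and> (segment_chain (butlast zs) c \<or> segment_chain (tl zs) c))"
  using assms by (subst segment_chain.simps) auto

text \<open>During the bisections a vertex list consists of a segment \<open>zs\<close> of
  original vertices, whose length is governed by the tag, followed by midpoints that were created
  before. The refinement edge joins the ends of \<open>zs\<close>, and the children drop one of
  them.\<close>

lemma children_segment:
  fixes zs ms :: "(real^'n::finite) list"
  assumes "length zs = k + 1" "1 \<le> k"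
  shows "children (zs @ ms, k) =
    {(butlast zs @ end_midpoint zs # ms, if k = 1 then CARD('n) else k - 1),
     (tl zs @ end_midpoint zs # ms, if k = 1 then CARD('n) else k - 1)}"
proof -
  have "zs \<noteq> []" using assms by auto
  then show ?thesis
    using assms unfolding children_def
    by (auto simp: Let_def nth_append hd_conv_nth last_conv_nth end_midpoint_def butlast_conv_take)
qed

text \<open>As the midpoints are inserted in front of the older ones, chains are built from their
  largest segment downwards. When a single vertex remains, it is the midpoint of its own trivial
  segment and the tag is reset to \<open>d\<close>.\<close>

lemma bisect_all_pow_segment:
  fixes zs ms :: "(real^'n::finite) list"
  assumes "length zs = k + 1" "1 \<le> k"
  shows "(bisect_all ^^ k) {(zs @ ms, k)} = {(map end_midpoint c @ ms, CARD('n)) | c. segment_chain zs c}"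
  using assms
proof (induction k arbitrary: zs ms)
  case (Suc k)
  have split: "(bisect_all ^^ Suc k) {(zs @ ms, Suc k)} =
      (\<Union>T\<in>children (zs @ ms, Suc k). (bisect_all ^^ k) {T})"
    unfolding funpow_Suc_right o_apply by (subst bisect_all_pow_Union) (simp add: bisect_all_def)
  have ch: "segment_chain zs d \<longleftrightarrow> (\<exists>c. d = c @ [zs] \<and> (segment_chain (butlast zs) c \<or> segment_chain (tl zs) c))" for d
    by (rule segment_chain_iff) (use Suc.prems in simp)
  show ?case
  proof (cases "k = 0")
    case True
    then obtain x y where zs: "zs = [x, y]" using Suc.prems by (auto simp: length_Suc_conv)
    have one: "segment_chain [z] c \<longleftrightarrow> c = [[z]]" for z :: "real^'n" and c
      by (subst segment_chain.simps) auto
    have "end_midpoint [z] = z" for z :: "real^'n" by (simp add: end_midpoint_def)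
    moreover have "segment_chain zs d \<longleftrightarrow> d = [[x], zs] \<or> d = [[y], zs]" for d
      unfolding ch using one zs by auto
    ultimately show ?thesis
      unfolding split using True children_segment[of zs 1 ms] zs
      by (auto simp: ex_disj_distrib conj_disj_distribL)
  next
    case False
    have "(bisect_all ^^ k) {(zs' @ end_midpoint zs # ms, k)}
        = {(map end_midpoint c @ end_midpoint zs # ms, CARD('n)) | c. segment_chain zs' c}" if "length zs' = k + 1" for zs'
      using Suc.IH[OF that] False by simp
    note IH = this
    have ex_snoc: "(\<exists>d. X d \<and> (\<exists>c. d = c @ [zs] \<and> Y c)) \<longleftrightarrow> (\<exists>c. X (c @ [zs]) \<and> Y c)" for X Y
      by blast
    have "{(map end_midpoint d @ ms, CARD('n)) | d. segment_chain zs d} = {(map end_midpoint c @ end_midpoint zs # ms, CARD('n)) | c.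
        segment_chain (butlast zs) c \<or> segment_chain (tl zs) c}"
      unfolding ch ex_snoc by simp
    then show ?thesis
      unfolding split using False children_segment[of zs "Suc k" ms] Suc.prems(1)
        IH[of "butlast zs"] IH[of "tl zs"] by auto
  qed
qed simp

lemma uniform_refinement_eq_bisect_all:
  fixes \<V> :: "'n::finite mesh"
  assumes "\<forall>T\<in>\<V>. length (fst T) = CARD('n) + 1 \<and> snd T = CARD('n)"
  shows "uniform_refinement \<V> = (bisect_all ^^ CARD('n)) \<V>"
proof -
  have "(bisect_all ^^ CARD('n)) {T} = {(map end_midpoint c, CARD('n)) | c. segment_chain (fst T) c}" if "T \<in> \<V>" for T
    using bisect_all_pow_segment[of "fst T" "CARD('n)" "[]"] assms[rule_format, OF that]
    by (cases T) (simp add: Suc_leI)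
  then show ?thesis
    unfolding uniform_refinement_def by (subst bisect_all_pow_Union) auto
qed

text \<open>Elements are bisected one at a time in arbitrary order. Since a mesh is a set, an
  element that is also a child of an element bisected before would be lost when it is bisected
  itself; the disjointness hypothesis excludes this.\<close>

lemma bisection_refinement_bisect_all:
  assumes "finite \<A>" "\<A> \<inter> bisect_all \<A> = {}"
  shows "bisection_refinement \<A> (bisect_all \<A>)"
proof -
  \<comment> \<open>\<open>\<B>\<close> is the set of elements that have been bisected so far.\<close>
  have "bisects_to\<^sup>*\<^sup>* \<A> ((\<A> - \<B>) \<union> bisect_all \<B>)" if "finite \<B>" "\<B> \<subseteq> \<A>" for \<B>
    using that
  proof (induction \<B> rule: finite_induct)
    case empty
    then show ?case by (simp add: bisect_all_def)
  next
    case (insert T \<B>)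
    have "T \<notin> bisect_all \<B>"
      using assms(2) insert.prems by (auto simp: bisect_all_def)
    then have "(\<A> - insert T \<B>) \<union> bisect_all (insert T \<B>)
        = ((\<A> - \<B>) \<union> bisect_all \<B>) - {T} \<union> children T"
      by (auto simp: bisect_all_def)
    then have "bisects_to ((\<A> - \<B>) \<union> bisect_all \<B>) ((\<A> - insert T \<B>) \<union> bisect_all (insert T \<B>))"
      using insert unfolding bisects_to_def by blast
    then show ?case using insert by (auto intro: rtranclp.rtrancl_into_rtrancl)
  qed
  from this[OF assms(1) subset_refl] show ?thesis by (simp add: bisection_refinement_def)
qed

lemma bisect_all_pow_tag:
  fixes \<V> :: "'n::finite mesh"
  assumes "\<forall>T\<in>\<V>. snd T = CARD('n)" "j < CARD('n)" "T \<in> (bisect_all ^^ j) \<V>"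
  shows "snd T = CARD('n) - j"
  using assms(2,3)
proof (induction j arbitrary: T)
  case (Suc j)
  from Suc.prems(2) have "T \<in> bisect_all ((bisect_all ^^ j) \<V>)" by simp
  then obtain S where S: "S \<in> (bisect_all ^^ j) \<V>" "T \<in> children S"
    unfolding bisect_all_def[of "(bisect_all ^^ j) \<V>"] by blast
  then have "snd S = CARD('n) - j" using Suc by simp
  then show ?case using S(2) Suc.prems(1) by (cases S) (auto simp: children_def Let_def)
qed (use assms in auto)

lemma children_well_tagged:
  assumes "well_tagged T" "S \<in> children T"
  shows "well_tagged S"
  using assms by (cases T) (auto simp: well_tagged_def children_def Let_def)

lemma child_elem_subset:
  assumes "well_tagged T" "S \<in> children T"
  shows "elem S \<subseteq> elem T"
proof -
  obtain xs \<gamma> where T: "T = (xs, \<gamma>)" by (cases T)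
  have xs: "\<gamma> < length xs" "xs \<noteq> []" using assms(1) by (auto simp: well_tagged_def T)
  have "xs ! 0 \<in> convex hull (set xs)" "xs ! \<gamma> \<in> convex hull (set xs)"
    using xs by (auto intro: hull_inc)
  then have m: "midpoint (xs ! 0) (xs ! \<gamma>) \<in> convex hull (set xs)"
    using closed_segment_subset_convex_hull midpoint_in_closed_segment by blast
  have "verts S \<subseteq> insert (midpoint (xs ! 0) (xs ! \<gamma>)) (set xs)"
    using assms(2) xs unfolding T children_def Let_def
    by (auto simp: verts_def dest!: in_set_takeD in_set_dropD list.set_sel(2)[OF xs(2)])
  then have "verts S \<subseteq> convex hull (set xs)" using m hull_subset[of "set xs" convex] by blast
  then show ?thesis by (simp add: elem_def T verts_def hull_minimal)
qed

lemma bisection_refinement_descendant: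
  assumes "bisection_refinement \<A> \<B>" "\<forall>T\<in>\<A>. well_tagged T"
  shows "(\<forall>T\<in>\<B>. well_tagged T) \<and> (\<forall>T\<in>\<A>. \<exists>S\<in>\<B>. elem S \<subseteq> elem T)"
  using assms(1) unfolding bisection_refinement_def
proof (induction rule: rtranclp_induct)
  case (step \<B> \<C>)
  then obtain T0 where T0: "T0 \<in> \<B>" "\<C> = (\<B> - {T0}) \<union> children T0" by (auto simp: bisects_to_def)
  have "well_tagged T0" using step T0 by auto
  have "\<exists>S'\<in>\<C>. elem S' \<subseteq> elem S" if "S \<in> \<B>" for S
  proof (cases "S = T0")
    case True
    obtain S' where "S' \<in> children T0" by (cases T0) (auto simp: children_def Let_def)
    then show ?thesis using True T0 child_elem_subset[OF \<open>well_tagged T0\<close>] by blast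
  next
    case False
    then show ?thesis using that T0 by blast
  qed
  then show ?case
    using step T0 children_well_tagged[OF \<open>well_tagged T0\<close>] by (metis DiffE UnE subset_trans)
qed (use assms(2) in auto)

lemma card_le_if_convex_hull_subset:
  fixes S T :: "'a::euclidean_space set"
  assumes "\<not> affine_dependent S" "finite T" "convex hull S \<subseteq> convex hull T"
  shows "card S \<le> card T"
proof -
  have "aff_dim S \<le> aff_dim T"
    using aff_dim_subset[OF assms(3)] by (simp add: aff_dim_convex_hull)
  also have "\<dots> \<le> int (card T) - 1" using assms(2) by (rule aff_dim_le_card)
  finally show ?thesis using aff_dim_affine_independent[OF assms(1)] by simp
qed

lemma compatible_mesh_conforming: "compatible_mesh \<V> \<Longrightarrow> conforming \<V>"
  unfolding conforming_def elem_def verts_def compatible_mesh_def compatible_simplices_def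
  by (auto simp: hull_mono[THEN subsetD, rotated])

lemma compatible_mesh_vertices:
  fixes \<V> :: "'n::finite mesh"
  assumes "compatible_mesh \<V>" "T \<in> \<V>"
  shows "card (verts T) = CARD('n) + 1" "\<not> affine_dependent (verts T)" "finite (verts T)" "well_tagged T"
    "distinct (fst T)"
  using assms unfolding compatible_mesh_def compatible_simplices_def verts_def well_tagged_def
  by (auto simp: distinct_card Suc_leI)

text \<open>If the intersection contains a full-dimensional simplex, the common face must have all
  \<open>d + 1\<close> vertices.\<close>

lemma verts_eq_if_common_simplex:
  fixes T T' :: "'n::finite tsimplex"
  assumes "elem T \<inter> elem T' = convex hull (verts T \<inter> verts T')"
    and "length (fst T) = CARD('n) + 1" "length (fst T') = CARD('n) + 1"
    and "\<not> affine_dependent S" "card S = CARD('n) + 1" "convex hull S \<subseteq> elem T" "convex hull S \<subseteq> elem T'"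
  shows "verts T = verts T'"
proof -
  have "card S \<le> card (verts T \<inter> verts T')"
    using assms(1,4,6,7) by (intro card_le_if_convex_hull_subset) (auto simp: verts_def)
  moreover have "card (verts T) \<le> CARD('n) + 1" "card (verts T') \<le> CARD('n) + 1"
    using assms(2,3) card_length[of "fst T"] card_length[of "fst T'"] by (auto simp: verts_def)
  ultimately have "verts T \<inter> verts T' = verts T" "verts T \<inter> verts T' = verts T'"
    using assms(5) by (intro card_seteq; auto simp: verts_def)+
  then show ?thesis by simp
qed

text \<open>Any two elements of the refinement stem from elements with compatible vertex lists.
  Elements with the same vertices list them in the same order and are therefore equal.\<close>

lemma compatible_mesh_uniform_refinement:
  fixes \<V> :: "'n::finite mesh"
  assumes "compatible_mesh \<V>"
  shows "compatible_mesh (uniform_refinement \<V>)"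
  unfolding compatible_mesh_def
proof (intro conjI ballI)
  have shape: "\<forall>T\<in>\<V>. length (fst T) = CARD('n) + 1 \<and> snd T = CARD('n)" and "finite \<V>"
    using assms by (auto simp: compatible_mesh_def)
  then show "finite (uniform_refinement \<V>)"
    using uniform_refinement_eq_bisect_all[OF shape] bisect_all_pow_finite_card by metis
  fix T assume "T \<in> uniform_refinement \<V>"
  then obtain S c where T: "S \<in> \<V>" "segment_chain (fst S) c" "T = (map end_midpoint c, CARD('n))"
    by (auto simp: uniform_refinement_def)
  then show "length (fst T) = CARD('n) + 1" "snd T = CARD('n)"
    using shape length_segment_chain[OF T(2)] by auto
  fix T' assume "T' \<in> uniform_refinement \<V>"
  then obtain S' c' where T': "S' \<in> \<V>" "segment_chain (fst S') c'" "T' = (map end_midpoint c', CARD('n))"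
    by (auto simp: uniform_refinement_def)
  have "compatible_simplices (fst S) (fst S')"
    using assms T(1) T'(1) by (auto simp: compatible_mesh_def)
  then show "compatible_simplices (fst T) (fst T')"
    using compatible_segment_chains T T' by simp
next
  show "inj_on verts (uniform_refinement \<V>)"
  proof (rule inj_onI)
    fix T T' assume "T \<in> uniform_refinement \<V>" "T' \<in> uniform_refinement \<V>" and eq: "verts T = verts T'"
    then obtain S c S' c' where T: "S \<in> \<V>" "segment_chain (fst S) c" "T = (map end_midpoint c, CARD('n))"
      and T': "S' \<in> \<V>" "segment_chain (fst S') c'" "T' = (map end_midpoint c', CARD('n))"
      by (auto simp: uniform_refinement_def)
    have "compatible_simplices (fst S) (fst S')"
      using assms T(1) T'(1) by (auto simp: compatible_mesh_def)
    from segment_chains_common_order[OF this T(2) T'(2)] eq T T'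
    have "map end_midpoint c = map end_midpoint c'"
      by (simp add: verts_def filter_id_conv[THEN iffD2])
    then show "T = T'" using T T' by simp
  qed
qed

text \<open>A common element \<open>T\<close> contains an element \<open>S\<close> of
  \<open>\<V>\<close>, since \<open>\<V>\<close> refines \<open>\<A>\<close>, and is contained in
  its parent \<open>S'\<close> in \<open>\<V>\<close>. Then \<open>S\<close> and \<open>S'\<close>
  overlap in a full simplex and coincide as sets, so that \<open>T\<close> fills
  \<open>S'\<close>. But one vertex of \<open>T\<close> is the midpoint of the first and the last
  vertex of \<open>S'\<close>, which is not an extreme point.\<close>

lemma coarsening_disjoint_uniform_refinement:
  fixes \<V> :: "'n::finite mesh"
  assumes V: "compatible_mesh \<V>" and A: "bisection_refinement \<A> \<V>" "\<forall>T\<in>\<A>. well_tagged T"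
  shows "\<A> \<inter> uniform_refinement \<V> = {}"
proof (rule ccontr)
  assume "\<A> \<inter> uniform_refinement \<V> \<noteq> {}"
  then obtain T where T: "T \<in> \<A>" "T \<in> uniform_refinement \<V>" by blast
  obtain S where S: "S \<in> \<V>" "elem S \<subseteq> elem T"
    using bisection_refinement_descendant[OF A] T(1) by blast
  obtain S' c where S': "S' \<in> \<V>" "segment_chain (fst S') c" "T = (map end_midpoint c, CARD('n))"
    using T(2) by (auto simp: uniform_refinement_def)
  have TS': "elem T \<subseteq> elem S'"
    using end_midpoints_in_convex_hull[OF S'(2)] by (simp add: elem_def verts_def S'(3) hull_minimal)
  have "verts S = verts S'"
  proof (rule verts_eq_if_common_simplex)
    show "elem S \<inter> elem S' = convex hull (verts S \<inter> verts S')"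
      using compatible_mesh_conforming[OF V] S(1) S'(1) by (auto simp: conforming_def)
    show "\<not> affine_dependent (verts S)" "card (verts S) = CARD('n) + 1"
      using compatible_mesh_vertices[OF V S(1)] by auto
    show "convex hull verts S \<subseteq> elem S" "convex hull verts S \<subseteq> elem S'"
      using S(2) TS' by (auto simp: elem_def)
  qed (use V S(1) S'(1) in \<open>auto simp: compatible_mesh_def\<close>)
  then have eq: "convex hull verts T = convex hull verts S'"
    using S(2) TS' by (auto simp: elem_def)
  let ?x = "hd (fst S')" and ?y = "last (fst S')"
  have "2 \<le> length (fst S')"
    using V S'(1) by (auto simp: compatible_mesh_def Suc_leI)
  then have xy: "?x \<noteq> ?y" "fst S' \<noteq> []"
    using compatible_mesh_vertices(5)[OF V S'(1)] by (cases "fst S'"; auto)+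
  have "end_midpoint (fst S') \<in> verts T"
    using last_segment_chain[OF S'(2)] last_in_set[of c] by (auto simp: verts_def S'(3))
  moreover have "\<not> affine_dependent (verts T)"
    using compatible_mesh_vertices(2)[OF compatible_mesh_uniform_refinement[OF V] T(2)] .
  ultimately have "end_midpoint (fst S') extreme_point_of (convex hull verts S')"
    using extreme_point_of_convex_hull_affine_independent eq by metis
  moreover have "?x \<in> convex hull verts S'" "?y \<in> convex hull verts S'"
    using xy by (auto simp: verts_def intro: hull_inc)
  moreover have "end_midpoint (fst S') \<in> open_segment ?x ?y"
    using xy by (simp add: end_midpoint_def)
  ultimately show False by (auto simp: extreme_point_of_def)
qed

text \<open>During the \<open>d\<close> rounds of bisections, the tags of all elements agree and
  differ from those of their children, which rules out collisions. In one dimension the only tag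
  is \<open>1\<close> and disjointness comes from geometry instead.\<close>

lemma bisection_refinement_uniform_refinement:
  fixes \<V> :: "'n::finite mesh"
  assumes V: "compatible_mesh \<V>"
  shows "bisection_refinement \<V> (uniform_refinement \<V>)"
proof -
  have shape: "\<forall>T\<in>\<V>. length (fst T) = CARD('n) + 1 \<and> snd T = CARD('n)" and fin: "finite \<V>"
    using assms by (auto simp: compatible_mesh_def)
  note uniform = uniform_refinement_eq_bisect_all[OF shape]
  have disjoint: "(bisect_all ^^ j) \<V> \<inter> bisect_all ((bisect_all ^^ j) \<V>) = {}" if j: "j < CARD('n)" for j
  proof (cases "CARD('n) = 1")
    case True
    then have "j = 0" using j by simp
    have "\<V> \<inter> uniform_refinement \<V> = {}"
      using V compatible_mesh_vertices(4)[OF V]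
      by (intro coarsening_disjoint_uniform_refinement) (auto simp: bisection_refinement_def)
    then show ?thesis using True uniform \<open>j = 0\<close> by simp
  next
    case False
    have tag: "snd T = CARD('n) - j" if "T \<in> (bisect_all ^^ j) \<V>" for T
      using bisect_all_pow_tag[OF _ j that] shape by blast
    have "snd S \<noteq> CARD('n) - j" if S: "S \<in> bisect_all ((bisect_all ^^ j) \<V>)" for S
    proof -
      obtain T where "T \<in> (bisect_all ^^ j) \<V>" "S \<in> children T"
        using S unfolding bisect_all_def[of "(bisect_all ^^ j) \<V>"] by blast
      then show ?thesis using tag[of T] j False
        by (cases T) (auto simp: children_def Let_def split: if_splits)
    qed
    then show ?thesis using tag by blast
  qed
  have "bisection_refinement \<V> ((bisect_all ^^ j) \<V>)" if "j \<le> CARD('n)" for j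
    using that
  proof (induction j)
    case (Suc j)
    have "bisection_refinement ((bisect_all ^^ j) \<V>) (bisect_all ((bisect_all ^^ j) \<V>))"
      using Suc.prems disjoint bisect_all_pow_finite_card[OF fin] by (intro bisection_refinement_bisect_all) auto
    then show ?case using Suc by (auto simp: bisection_refinement_def)
  qed (simp add: bisection_refinement_def)
  then show ?thesis by (simp add: uniform)
qed

lemma uniform_refinement_pow:
  fixes \<V> :: "'n::finite mesh"
  assumes "compatible_mesh \<V>"
  shows "compatible_mesh ((uniform_refinement ^^ l) \<V>) \<and>
    card ((uniform_refinement ^^ l) \<V>) \<le> (2 ^ CARD('n)) ^ l * card \<V>"
proof (induction l)
  case (Suc l)
  let ?U = "(uniform_refinement ^^ l) \<V>"
  have "uniform_refinement ?U = (bisect_all ^^ CARD('n)) ?U"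
    using Suc by (intro uniform_refinement_eq_bisect_all) (simp add: compatible_mesh_def)
  moreover have "finite ?U" using Suc by (simp add: compatible_mesh_def)
  ultimately have "card (uniform_refinement ?U) \<le> 2 ^ CARD('n) * card ?U"
    using bisect_all_pow_finite_card by metis
  also have "\<dots> \<le> 2 ^ CARD('n) * ((2 ^ CARD('n)) ^ l * card \<V>)"
    using Suc by (intro mult_left_mono) auto
  finally show ?case using Suc compatible_mesh_uniform_refinement[of ?U] by simp
qed (use assms in simp)

text \<open>Each element of \<open>\<A>\<close> contains an element of \<open>\<V>\<close>. By
  conformity, elements of \<open>\<A>\<close> that contain the same one have the same vertices,
  and there are only boundedly many tagged lists of \<open>d + 1\<close> vertices from a given
  set. This crude count avoids a discussion of whether different elements of \<open>\<A>\<close>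
  can have the same vertices.\<close>

lemma card_conforming_coarsening:
  fixes \<V> :: "'n::finite mesh"
  assumes V: "compatible_mesh \<V>" and A: "bisection_refinement \<A> \<V>" "\<forall>T\<in>\<A>. well_tagged T"
    and conf: "conforming \<A>"
  shows "card \<A> \<le> card \<V> * ((CARD('n) + 1) ^ (CARD('n) + 1) * CARD('n))"
proof -
  let ?d = "CARD('n)"
  have finV: "finite \<V>" using V by (simp add: compatible_mesh_def)
  obtain f where f: "\<And>T. T \<in> \<A> \<Longrightarrow> f T \<in> \<V> \<and> elem (f T) \<subseteq> elem T"
    using bisection_refinement_descendant[OF A] by metis
  have same_verts: "verts T = verts T'" if "T \<in> \<A>" "T' \<in> \<A>" "f T = f T'" for T T'
  proof (rule verts_eq_if_common_simplex)
    show "elem T \<inter> elem T' = convex hull (verts T \<inter> verts T')"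
      using conf that by (auto simp: conforming_def)
    show "\<not> affine_dependent (verts (f T))" "card (verts (f T)) = CARD('n) + 1"
      using compatible_mesh_vertices[OF V] f that(1) by auto
    show "convex hull verts (f T) \<subseteq> elem T" "convex hull verts (f T) \<subseteq> elem T'"
      using f that by (metis elem_def)+
  qed (use A(2) that in \<open>auto simp: well_tagged_def\<close>)
  define X where "X = verts ` \<A>"
  have "verts T = verts (inv_into \<A> f (f T))" if "T \<in> \<A>" for T
    using that f_inv_into_f[of "f T" f \<A>] inv_into_into[of "f T" f \<A>]
    by (intro same_verts) auto
  then have "X = (\<lambda>S. verts (inv_into \<A> f S)) ` f ` \<A>"
    unfolding X_def by (auto simp: image_image)
  moreover have "finite (f ` \<A>)" "card (f ` \<A>) \<le> card \<V>"
    using f finV finite_subset[of "f ` \<A>" \<V>] card_mono[of \<V> "f ` \<A>"] by blast+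
  ultimately have X: "finite X" "card X \<le> card \<V>"
    using card_image_le[of "f ` \<A>" "\<lambda>S. verts (inv_into \<A> f S)"] by auto
  let ?tagged = "\<lambda>V. {xs. set xs \<subseteq> V \<and> length xs = ?d + 1} \<times> {1..?d}"
  have tagged: "finite (?tagged V) \<and> card (?tagged V) \<le> (?d + 1) ^ (?d + 1) * ?d" if "V \<in> X" for V
  proof -
    obtain T where T: "T \<in> \<A>" "V = verts T" using \<open>V \<in> X\<close> by (auto simp: X_def)
    then have fin: "finite V" by (simp add: verts_def)
    have "card V \<le> ?d + 1"
      using A(2) T card_length[of "fst T"] by (auto simp: well_tagged_def verts_def)
    then have "card {xs. set xs \<subseteq> V \<and> length xs = ?d + 1} \<le> (?d + 1) ^ (?d + 1)"
      unfolding card_lists_length_eq[OF fin] by (rule power_mono) simp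
    then show ?thesis
      using finite_lists_length_eq[OF fin] by (simp add: card_cartesian_product)
  qed
  have "T \<in> ?tagged (verts T)" if "T \<in> \<A>" for T
    using A(2) that by (cases T) (auto simp: well_tagged_def verts_def)
  then have "\<A> \<subseteq> (\<Union>V\<in>X. ?tagged V)"
    unfolding X_def by blast
  then have "card \<A> \<le> card (\<Union>V\<in>X. ?tagged V)"
    using X(1) tagged by (intro card_mono) blast+
  also have "\<dots> \<le> (\<Sum>V\<in>X. card (?tagged V))"
    by (rule card_UN_le[OF X(1)])
  also have "\<dots> \<le> (\<Sum>V\<in>X. (?d + 1) ^ (?d + 1) * ?d)"
    using tagged by (intro sum_mono) blast
  also have "\<dots> = card X * ((?d + 1) ^ (?d + 1) * ?d)" by simp
  also have "\<dots> \<le> card \<V> * ((?d + 1) ^ (?d + 1) * ?d)" using X(2) by (intro mult_right_mono) auto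
  finally show ?thesis .
qed

lemma initial_triangulation_compatible:
  assumes "initial_triangulation U (\<V> :: 'n::finite mesh)"
  shows "compatible_mesh \<V>"
proof -
  have simplices: "length (fst T) = CARD('n) + 1 \<and> distinct (fst T) \<and>
      \<not> affine_dependent (set (fst T)) \<and> snd T = CARD('n)" if "T \<in> \<V>" for T
  proof -
    have "\<forall>(xs, \<gamma>)\<in>\<V>. length xs = CARD('n) + 1 \<and> distinct xs \<and> \<not> affine_dependent (set xs) \<and>
        \<gamma> = CARD('n)"
      using assms unfolding initial_triangulation_def by blast
    from bspec[OF this that] show ?thesis by (simp add: split_beta)
  qed
  have order: "let common = (\<lambda>x. x \<in> set (fst T) \<inter> set (fst T')) in
      filter common (fst T) = filter common (fst T') \<or> filter common (fst T) = rev (filter common (fst T'))"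
    if "T \<in> \<V>" "T' \<in> \<V>" for T T'
  proof -
    have "\<forall>(xs, \<gamma>)\<in>\<V>. \<forall>(ys, \<gamma>')\<in>\<V>.
        let common = set xs \<inter> set ys;
            xs' = filter (\<lambda>x. x \<in> common) xs;
            ys' = filter (\<lambda>x. x \<in> common) ys
        in xs' = ys' \<or> xs' = rev ys'"
      using assms unfolding initial_triangulation_def by blast
    from bspec[OF this that(1)] have "\<forall>(ys, \<gamma>')\<in>\<V>.
        let common = set (fst T) \<inter> set ys;
            xs' = filter (\<lambda>x. x \<in> common) (fst T);
            ys' = filter (\<lambda>x. x \<in> common) ys
        in xs' = ys' \<or> xs' = rev ys'" by (simp only: split_beta)
    from bspec[OF this that(2)] show ?thesis by (simp only: split_beta Let_def)
  qed
  have "conforming \<V>" "finite \<V>" "inj_on verts \<V>"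
    using assms by (auto simp: initial_triangulation_def)
  then show ?thesis
    using simplices order
    unfolding compatible_mesh_def compatible_simplices_def conforming_def elem_def verts_def
    by blast
qed

section \<open>Growth of the meshes in a run\<close>

text \<open>The uniform mesh on the next level is an admissible refinement of the current one,
  hence finer than the coarsest admissible refinement.\<close>

lemma run_mesh_coarsens_uniform_refinement:
  fixes P :: "'n::finite pde"
  assumes T0: "compatible_mesh \<T>\<^sub>0"
    and run: "afem_run P p \<Psi> \<T>\<^sub>0 \<theta> Cmark lam u00 \<T> \<M> u"
  shows "(l, k) \<in> index_set (solver_stops P lam \<T> u) \<Longrightarrow>
    conforming (\<T> l) \<and> (\<forall>T\<in>\<T> l. well_tagged T) \<and>
    bisection_refinement (\<T> l) ((uniform_refinement ^^ l) \<T>\<^sub>0)"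
proof (induction l k rule: index_set.induct)
  case 1
  have "\<T> 0 = \<T>\<^sub>0" using run by (simp add: afem_run_def)
  then show ?case
    using compatible_mesh_conforming[OF T0] compatible_mesh_vertices(4)[OF T0]
    by (simp add: bisection_refinement_def)
next
  case (2 l k)
  then show ?case by blast
next
  case (3 l k)
  have "\<M> l \<in> doerfler_sets P \<theta> (\<T> l) (u l k)" and refine: "is_refine (\<T> l) (\<M> l) (\<T> (Suc l))"
    using run 3 unfolding afem_run_def by (auto split: if_splits)
  then have marked: "\<M> l \<subseteq> \<T> l" by (simp add: doerfler_sets_def)
  let ?U = "(uniform_refinement ^^ l) \<T>\<^sub>0"
  have U: "compatible_mesh ?U" using uniform_refinement_pow[OF T0] by blast
  have adm: "bisection_refinement (\<T> l) (\<T> (Suc l))" "conforming (\<T> (Suc l))"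
    using refine by (auto simp: is_refine_def admissible_refinement_def)
  have "bisection_refinement (\<T> l) (uniform_refinement ?U)"
    using 3 bisection_refinement_uniform_refinement[OF U]
    unfolding bisection_refinement_def by (meson rtranclp_trans)
  moreover have "conforming (uniform_refinement ?U)"
    using U compatible_mesh_uniform_refinement compatible_mesh_conforming by blast
  moreover have "\<M> l \<inter> uniform_refinement ?U = {}"
    using coarsening_disjoint_uniform_refinement[OF U] 3 marked by blast
  ultimately have "bisection_refinement (\<T> (Suc l)) (uniform_refinement ?U)"
    using refine unfolding is_refine_def admissible_refinement_def by blast
  then show ?case
    using adm bisection_refinement_descendant[OF adm(1)] 3 by simp
qed

lemma run_mesh_card_le:
  fixes P :: "'n::finite pde"
  assumes T0: "compatible_mesh \<T>\<^sub>0"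
    and run: "afem_run P p \<Psi> \<T>\<^sub>0 \<theta> Cmark lam u00 \<T> \<M> u"
  obtains K where "0 < K"
    "\<And>i. i \<in> index_set (solver_stops P lam \<T> u) \<Longrightarrow> real (card (\<T> (fst i))) \<le> K * (2 ^ CARD('n)) ^ fst i"
proof -
  \<comment> \<open>Adding one makes the constant positive even for an empty initial mesh.\<close>
  define K where "K = card \<T>\<^sub>0 * ((CARD('n) + 1) ^ (CARD('n) + 1) * CARD('n)) + 1"
  have "real (card (\<T> (fst i))) \<le> real K * (2 ^ CARD('n)) ^ fst i"
    if i: "i \<in> index_set (solver_stops P lam \<T> u)" for i
  proof -
    let ?l = "fst i" and ?U = "(uniform_refinement ^^ fst i) \<T>\<^sub>0"
    have U: "compatible_mesh ?U" "card ?U \<le> (2 ^ CARD('n)) ^ ?l * card \<T>\<^sub>0"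
      using uniform_refinement_pow[OF T0] by auto
    have "card (\<T> ?l) \<le> card ?U * ((CARD('n) + 1) ^ (CARD('n) + 1) * CARD('n))"
      using run_mesh_coarsens_uniform_refinement[OF T0 run, of ?l "snd i"] i
      by (intro card_conforming_coarsening[OF U(1)]) auto
    also have "\<dots> \<le> (2 ^ CARD('n)) ^ ?l * card \<T>\<^sub>0 * ((CARD('n) + 1) ^ (CARD('n) + 1) * CARD('n))"
      by (rule mult_right_mono[OF U(2)]) simp
    also have "\<dots> \<le> K * (2 ^ CARD('n)) ^ ?l"
      by (simp add: K_def algebra_simps)
    finally have "real (card (\<T> ?l)) \<le> real (K * (2 ^ CARD('n)) ^ ?l)" by (simp only: of_nat_le_iff)
    then show ?thesis by simp
  qed
  moreover have "0 < real K" unfolding K_def by linarith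
  ultimately show thesis using that by blast
qed

section \<open>Finite rates\<close>

lemma R_linear_level_decay:
  assumes Q: "Q = index_set stops" and H: "\<And>i. 0 \<le> H i"
    and lin: "full_R_linear Q H Clin qlin" and q: "0 < qlin" "qlin < 1" and C: "0 < Clin"
    and i: "i \<in> Q"
  shows "H i \<le> Clin * qlin ^ fst i * H (0, 0)"
proof -
  have 0: "(0, 0) \<in> Q" unfolding Q by (rule index_set.intros)
  have lev: "fst i < step_count Q i" using level_less_step_count i unfolding Q by blast
  have c0: "step_count Q (0, 0) = 1" unfolding Q by (rule step_count_start)
  have "H i \<le> Clin * qlin ^ (step_count Q i - step_count Q (0, 0)) * H (0, 0)"
    using lin 0 i lev c0 unfolding full_R_linear_def by fastforce
  also have "\<dots> \<le> Clin * qlin ^ fst i * H (0, 0)"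
    using q C H lev c0 by (intro mult_right_mono mult_left_mono power_decreasing) auto
  finally show ?thesis .
qed

lemma rate_dofs_finite_if_bounded:
  assumes "\<And>i. i \<in> Q \<Longrightarrow> real (card (\<T> (fst i))) powr s * H i \<le> B"
  shows "rate_dofs Q \<T> H s < \<infinity>"
proof -
  have "rate_dofs Q \<T> H s \<le> ennreal B"
    unfolding rate_dofs_def using assms by (intro SUP_least ennreal_leI)
  then show ?thesis by (simp add: le_less_trans)
qed

text \<open>The exponent \<open>- log B qlin\<close> solves \<open>B powr s * qlin = 1\<close>; up
  to this exponent the decay compensates the growth.\<close>

lemma rate_dofs_finite_if_exponential_growth:
  assumes card: "\<And>i. i \<in> Q \<Longrightarrow> real (card (\<T> (fst i))) \<le> K * B ^ fst i" and K: "0 < K" and B: "1 < B"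
    and decay: "\<And>i. i \<in> Q \<Longrightarrow> 0 \<le> H i \<and> H i \<le> C * qlin ^ fst i" and q: "0 < qlin" "qlin < 1" and C: "0 \<le> C"
  shows "\<exists>s\<^sub>0>0. \<forall>s. 0 < s \<and> s \<le> s\<^sub>0 \<longrightarrow> rate_dofs Q \<T> H s < \<infinity>"
proof (intro exI conjI allI impI)
  show "0 < - log B qlin" using B q by (simp add: log_less_zero_cancel_iff)
  fix s assume s: "0 < s \<and> s \<le> - log B qlin"
  have "B powr s \<le> B powr (- log B qlin)" using s B by (intro powr_mono) auto
  also have "\<dots> = 1 / qlin" using B q by (simp add: powr_minus_divide)
  finally have le1: "B powr s * qlin \<le> 1" using q by (simp add: field_simps)
  show "rate_dofs Q \<T> H s < \<infinity>"
  proof (rule rate_dofs_finite_if_bounded)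
    fix i assume i: "i \<in> Q"
    have "real (card (\<T> (fst i))) powr s * H i \<le> (K * B ^ fst i) powr s * (C * qlin ^ fst i)"
      using card[OF i] decay[OF i] s by (intro mult_mono powr_mono2) auto
    also have "(K * B ^ fst i) powr s = K powr s * (B powr s) ^ fst i"
      using K B by (simp add: powr_mult powr_powr mult.commute flip: powr_realpow)
    also have "K powr s * (B powr s) ^ fst i * (C * qlin ^ fst i) = K powr s * C * (B powr s * qlin) ^ fst i"
      by (simp add: power_mult_distrib)
    also have "\<dots> \<le> K powr s * C * 1"
      using le1 q C by (intro mult_left_mono power_le_one) auto
    finally show "real (card (\<T> (fst i))) powr s * H i \<le> K powr s * C" by simp
  qed
qed

text \<open>The last level may contain infinitely many steps, but they all share one mesh.\<close>

lemma rate_dofs_finite_if_finite_levels: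
  assumes Q: "Q = index_set stops" and fin: "last_level Q < \<infinity>"
    and bound: "\<And>i. i \<in> Q \<Longrightarrow> 0 \<le> H i \<and> H i \<le> C" and s: "0 < s"
  shows "rate_dofs Q \<T> H s < \<infinity>"
proof -
  obtain L where L: "last_level Q = enat L" using fin by (cases "last_level Q") auto
  have level: "fst i \<le> L" if "i \<in> Q" for i
  proof -
    have "(fst i, 0) \<in> Q"
      using index_set_level_start[of "fst i" "snd i" stops "fst i"] that unfolding Q by simp
    then have "enat (fst i) \<le> last_level Q" unfolding last_level_def by (intro SUP_upper) auto
    then show ?thesis using L by simp
  qed
  define N where "N = (\<Sum>l\<le>L. card (\<T> l))"
  show ?thesis
  proof (rule rate_dofs_finite_if_bounded)
    fix i assume i: "i \<in> Q"
    have "card (\<T> (fst i)) \<le> N"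
      unfolding N_def using level[OF i] by (intro member_le_sum) auto
    then show "real (card (\<T> (fst i))) powr s * H i \<le> real N powr s * C"
      using bound[OF i] s by (intro mult_mono powr_mono2) auto
  qed
qed

theorem corollary14:
  fixes P :: "'n::finite pde"
    and \<T>\<^sub>0 :: "'n mesh"
    and p :: nat
    and uexact u00 :: "real^'n \<Rightarrow> real"
    and ustar :: "'n mesh \<Rightarrow> real^'n \<Rightarrow> real"
    and \<Psi> :: "'n mesh \<Rightarrow> (real^'n \<Rightarrow> real) \<Rightarrow> (real^'n \<Rightarrow> real)"
    and \<theta> Cmark lam Clin qlin :: real
    and \<T> \<M> :: "nat \<Rightarrow> 'n mesh"
    and u :: "nat \<Rightarrow> nat \<Rightarrow> real^'n \<Rightarrow> real"
    and Q :: "(nat \<times> nat) set"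
    and H :: "nat \<times> nat \<Rightarrow> real"
  assumes "model_problem P"
    and "solves_in P (H10 (Dom P)) uexact"
    and "initial_triangulation (Dom P) \<T>\<^sub>0"
    and "1 \<le> p"
    and "\<forall>\<T>'\<in>meshes \<T>\<^sub>0. solves_in P (fe_space P p \<T>') (ustar \<T>')"
    and "estimator_well_defined P p \<T>\<^sub>0"
    and "contractive_solver P p \<T>\<^sub>0 ustar \<Psi>"
    and "0 < \<theta>" "\<theta> \<le> 1" "1 \<le> Cmark" "0 < lam"
    and "afem_run P p \<Psi> \<T>\<^sub>0 \<theta> Cmark lam u00 \<T> \<M> u"
    and "Q = index_set (solver_stops P lam \<T> u)"
    and "H = quasi_error P ustar \<T> u"
    and "0 < qlin" "qlin < 1" "0 < Clin"
    and "full_R_linear Q H Clin qlin"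
  shows "(\<forall>s>0. rate_dofs Q \<T> H s \<le> rate_cost Q \<T> H s \<and>
                rate_cost Q \<T> H s \<le> ennreal (C_cost Clin qlin s) * rate_dofs Q \<T> H s \<and>
                0 < C_cost Clin qlin s) \<and>
         (\<exists>s\<^sub>0>0. \<forall>s. 0 < s \<and> s \<le> s\<^sub>0 \<longrightarrow> rate_dofs Q \<T> H s < \<infinity>) \<and>
         (last_level Q < \<infinity> \<longrightarrow> (\<forall>s>0. rate_dofs Q \<T> H s < \<infinity>))"
proof (intro conjI allI impI)
  note Q = \<open>Q = index_set _\<close> and lin = \<open>full_R_linear Q H Clin qlin\<close>
    and q = \<open>0 < qlin\<close> \<open>qlin < 1\<close> and C = \<open>0 < Clin\<close>
  have H: "0 \<le> H i" for i
    unfolding \<open>H = _\<close> by (rule quasi_error_nonneg[OF \<open>model_problem P\<close>])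
  {
    fix s :: real assume s: "0 < s"
    show "rate_dofs Q \<T> H s \<le> rate_cost Q \<T> H s"
      using Q H s by (rule rate_dofs_le_rate_cost)
    show "rate_cost Q \<T> H s \<le> ennreal (C_cost Clin qlin s) * rate_dofs Q \<T> H s"
      using Q H lin q C s by (rule rate_cost_le_rate_dofs)
    show "0 < C_cost Clin qlin s" using q C s by (rule C_cost_pos)
  }
  have decay: "H i \<le> Clin * H (0, 0) * qlin ^ fst i" if "i \<in> Q" for i
    using R_linear_level_decay[OF Q H lin q C that] by (simp add: mult_ac)
  have C0: "0 \<le> Clin * H (0, 0)" using C H by simp
  obtain K where K: "0 < K" "\<And>i. i \<in> Q \<Longrightarrow> real (card (\<T> (fst i))) \<le> K * (2 ^ CARD('n)) ^ fst i"
    using run_mesh_card_le[OF initial_triangulation_compatible \<open>afem_run _ _ _ _ _ _ _ _ _ _ _\<close>]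
      \<open>initial_triangulation _ _\<close> unfolding Q by blast
  show "\<exists>s\<^sub>0>0. \<forall>s. 0 < s \<and> s \<le> s\<^sub>0 \<longrightarrow> rate_dofs Q \<T> H s < \<infinity>"
    by (rule rate_dofs_finite_if_exponential_growth[OF K(2,1) _ _ q C0]) (use H decay in auto)
  fix s :: real assume "last_level Q < \<infinity>" and s: "0 < s"
  moreover have "0 \<le> H i \<and> H i \<le> Clin * H (0, 0)" if "i \<in> Q" for i
    using H decay[OF that] mult_left_mono[OF power_le_one C0, of qlin "fst i"] q by fastforce
  ultimately show "rate_dofs Q \<T> H s < \<infinity>"
    using Q by (intro rate_dofs_finite_if_finite_levels[OF Q])
qed

end
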